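(* Let $\alpha\in[0,1)$, let $\bar k,\bar\sigma,\bar\eta>0$, and let $(\beta,\delta)$ be an admissible pair of scaling parameters for $\alpha$. Let $\hat\xi_t$ be the skew term of the corresponding ATS model and $\hat\xi_0=\lim_{t\to0^+}\hat\xi_t$. If $\beta<1$ and $\delta=-\tfrac12$, then $\hat\xi_0=-\sqrt{\frac{\pi}{2}}$. If $\beta=1$ and $\delta=-\tfrac12$, then $$\hat\xi_0=-\sqrt{\frac{\pi}{2}}\;\mathbb E\left[\mathrm{erf}\left(\bar\sigma\bar\eta\, r(S_t)\right)\right],\qquad r(z):=\sqrt2\left(\frac{1}{\sqrt z}-\sqrt z\right),$$ where $\mathrm{erf}(z):=2N(z/\sqrt2)-1$ (for $\beta=1$ the law of $S_t$ does not depend on $t$).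
   Context: Parameters. $\alpha\in[0,1)$; $\bar k,\bar\sigma,\bar\eta>0$; $\beta,\delta\in\mathbb R$. The pair $(\beta,\delta)$ is admissible (for $\alpha$) if either $\beta=\delta=0$, or $0\le\beta\le\frac{1}{1-\alpha/2}$ and $-\min\left(\beta,\frac{1-\beta(1-\alpha)}{\alpha}\right)<\delta\le0$ (for $\alpha=0$ the last condition reads $-\beta<\delta\le0$). Put $k_t=\bar k t^\beta$, $\eta_t=\bar\eta t^\delta$ for $t>0$. Model (ATS). For $t>0$, $S_t$ is a positive random variable with Laplace transform $\mathcal L_t(u)=\mathbb E[e^{-uS_t}]$ given by $\ln\mathcal L_t(u)=\frac{t}{k_t}\frac{1-\alpha}{\alpha}\left\{1-\left(1+\frac{u k_t}{(1-\alpha)t}\right)^{\alpha}\right\}$ if $0<\alpha<1$ and $\ln\mathcal L_t(u)=-\frac{t}{k_t}\ln\left(1+\frac{uk_t}{t}\right)$ if $\alpha=0$. Define $\varphi_t$ by $\varphi_t t=-\ln\mathcal L_t(t\bar\sigma^2\eta_t)$, and $f_t=-\left(\eta_t+\tfrac12\right)\bar\sigma^2 S_t t+\bar\sigma\sqrt{S_t t}\,g+\varphi_t t$, with $g$ standard normal independent of $S_t$ (so $\mathbb E[e^{f_t}]=1$). Implied volatility. $N$ is the standard normal cumulative distribution function. For $t>0$ and $y\in\mathbb R$, $\mathcal I_t(y)>0$ is the unique solution of $\mathbb E[(e^{f_t}-e^{y\sqrt t})^+]=N\left(-\frac{y}{\mathcal I_t(y)}+\frac{\mathcal I_t(y)\sqrt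 t}{2}\right)-e^{y\sqrt t}N\left(-\frac{y}{\mathcal I_t(y)}-\frac{\mathcal I_t(y)\sqrt t}{2}\right)$. The skew term is $\hat\xi_t=\frac{d\mathcal I_t(y)}{dy}\big|_{y=0}$. Convention: in this statement $\mathrm{erf}(z)$ denotes $2N(z/\sqrt2)-1$, which is not the usual normalization of the error function. *)

theory Defs
  imports "HOL-Probability.Probability"
begin

definition admissible :: "real \<Rightarrow> real \<Rightarrow> real \<Rightarrow> bool" where
  "admissible \<alpha> \<beta> \<delta> \<longleftrightarrow>
     (\<beta> = 0 \<and> \<delta> = 0) \<or>
     (0 \<le> \<beta> \<and> \<beta> \<le> 1 / (1 - \<alpha> / 2) \<and>
      (if \<alpha> = 0 then - \<beta> else - min \<beta> ((1 - \<beta> * (1 - \<alpha>)) / \<alpha>)) < \<delta> \<and> \<delta> \<le> 0)"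

text \<open>Power-law scaling, \<open>k\<^sub>t = k t\<^sup>\<beta>\<close> and \<open>\<eta>\<^sub>t = \<eta> t\<^sup>\<delta>\<close>; only used for \<open>t > 0\<close>.\<close>

definition scaled :: "real \<Rightarrow> real \<Rightarrow> real \<Rightarrow> real" where
  "scaled c p t = c * t powr p"

definition laplace_transform :: "'a measure \<Rightarrow> ('a \<Rightarrow> real) \<Rightarrow> real \<Rightarrow> real" where
  "laplace_transform M X u = (\<integral>\<omega>. exp (- u * X \<omega>) \<partial>M)"

text \<open>The prescribed \<open>ln L\<^sub>t(u)\<close>; the argument \<open>\<kappa>\<close> is the value \<open>k\<^sub>t\<close>.\<close>

definition ats_log_laplace :: "real \<Rightarrow> real \<Rightarrow> real \<Rightarrow> real \<Rightarrow> real" where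
  "ats_log_laplace \<alpha> \<kappa> t u =
     (if \<alpha> = 0 then - (t / \<kappa>) * ln (1 + u * \<kappa> / t)
      else t / \<kappa> * ((1 - \<alpha>) / \<alpha>) * (1 - (1 + u * \<kappa> / ((1 - \<alpha>) * t)) powr \<alpha>))"

text \<open>The model is a family indexed by \<open>t > 0\<close>. Only the joint law of \<open>(S\<^sub>t, g\<^sub>t)\<close> at each
  fixed \<open>t\<close> matters, so the probability space and the Gaussian variable may depend on \<open>t\<close>.\<close>

definition ats_model ::
  "real \<Rightarrow> real \<Rightarrow> real \<Rightarrow> (real \<Rightarrow> 'a measure) \<Rightarrow> (real \<Rightarrow> 'a \<Rightarrow> real) \<Rightarrow> (real \<Rightarrow> 'a \<Rightarrow> real) \<Rightarrow> bool" where
  "ats_model \<alpha> k \<beta> M S g \<longleftrightarrow>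
     (\<forall>t>0. prob_space (M t) \<and>
            S t \<in> borel_measurable (M t) \<and> (AE \<omega> in M t. 0 < S t \<omega>) \<and>
            (\<forall>u\<ge>0. ln (laplace_transform (M t) (S t) u) = ats_log_laplace \<alpha> (scaled k \<beta> t) t u) \<and>
            distributed (M t) lborel (g t) std_normal_density \<and>
            prob_space.indep_var (M t) borel (S t) borel (g t))"

text \<open>In the definitions below \<open>M\<close>, \<open>X\<close>, \<open>g\<close>, \<open>h\<close> stand for the values
  \<open>M\<^sub>t\<close>, \<open>S\<^sub>t\<close>, \<open>g\<^sub>t\<close>, \<open>\<eta>\<^sub>t\<close> at maturity \<open>t\<close>.\<close>

definition ats_phi :: "real \<Rightarrow> real \<Rightarrow> 'a measure \<Rightarrow> ('a \<Rightarrow> real) \<Rightarrow> real \<Rightarrow> real" where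
  "ats_phi \<sigma> h M X t = - ln (laplace_transform M X (t * \<sigma>\<^sup>2 * h)) / t"

definition ats_forward ::
  "real \<Rightarrow> real \<Rightarrow> 'a measure \<Rightarrow> ('a \<Rightarrow> real) \<Rightarrow> ('a \<Rightarrow> real) \<Rightarrow> real \<Rightarrow> 'a \<Rightarrow> real" where
  "ats_forward \<sigma> h M X g t \<omega> =
     - (h + 1 / 2) * \<sigma>\<^sup>2 * X \<omega> * t + \<sigma> * sqrt (X \<omega> * t) * g \<omega> + ats_phi \<sigma> h M X t * t"

definition std_normal_cdf :: "real \<Rightarrow> real" where
  "std_normal_cdf = cdf std_normal_distribution"

definition black_call :: "real \<Rightarrow> real \<Rightarrow> real \<Rightarrow> real" where
  "black_call t y v =
     std_normal_cdf (- y / v + v * sqrt t / 2)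
     - exp (y * sqrt t) * std_normal_cdf (- y / v - v * sqrt t / 2)"

definition ats_call ::
  "real \<Rightarrow> real \<Rightarrow> 'a measure \<Rightarrow> ('a \<Rightarrow> real) \<Rightarrow> ('a \<Rightarrow> real) \<Rightarrow> real \<Rightarrow> real \<Rightarrow> real" where
  "ats_call \<sigma> h M X g t y =
     (\<integral>\<omega>. max 0 (exp (ats_forward \<sigma> h M X g t \<omega>) - exp (y * sqrt t)) \<partial>M)"

definition implied_vol ::
  "real \<Rightarrow> real \<Rightarrow> 'a measure \<Rightarrow> ('a \<Rightarrow> real) \<Rightarrow> ('a \<Rightarrow> real) \<Rightarrow> real \<Rightarrow> real \<Rightarrow> real" where
  "implied_vol \<sigma> h M X g t y = (THE v. 0 < v \<and> ats_call \<sigma> h M X g t y = black_call t y v)"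

definition skew_term ::
  "real \<Rightarrow> real \<Rightarrow> real \<Rightarrow> (real \<Rightarrow> 'a measure) \<Rightarrow> (real \<Rightarrow> 'a \<Rightarrow> real) \<Rightarrow> (real \<Rightarrow> 'a \<Rightarrow> real) \<Rightarrow> real \<Rightarrow> real" where
  "skew_term \<sigma> \<eta> \<delta> M S g t =
     deriv (\<lambda>y. implied_vol \<sigma> (scaled \<eta> \<delta> t) (M t) (S t) (g t) t y) 0"

text \<open>Not the usual normalization of the error function.\<close>

definition erf :: "real \<Rightarrow> real" where
  "erf z = 2 * std_normal_cdf (z / sqrt 2) - 1"

definition r_fun :: "real \<Rightarrow> real" where
  "r_fun z = sqrt 2 * (1 / sqrt z - sqrt z)"

end

theory Submission
  imports Defs "HOL-Real_Asymp.Real_Asymp"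
begin

text \<open>
  Differentiating \<open>C(y) = B(y, I(y))\<close> at \<open>y = 0\<close>, where \<open>C'(0) = - sqrt t * P(f\<^sub>t > 0)\<close>, gives the skew
  \<open>(N(- a\<^sub>t) - P(f\<^sub>t > 0)) / N'(a\<^sub>t)\<close> with \<open>a\<^sub>t = I\<^sub>t(0) * sqrt t / 2\<close> and \<open>N(a\<^sub>t) - N(- a\<^sub>t) = C\<^sub>t(0)\<close>.
  As \<open>E exp f\<^sub>t = 1\<close>, \<open>C\<^sub>t(0)\<close> is also the put price \<open>E (1 - exp f\<^sub>t)\<^sup>+\<close>, hence at most the mean of the
  negative part of \<open>f\<^sub>t\<close>, which vanishes as \<open>t\<close> tends to \<open>0\<close>. So \<open>a\<^sub>t\<close> tends to \<open>0\<close>, and only the limit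
  of \<open>P(f\<^sub>t > 0)\<close> matters.

  Conditioning on \<open>S\<^sub>t\<close>, this probability is \<open>E N(A\<^sub>t / sqrt S\<^sub>t - B\<^sub>t * sqrt S\<^sub>t)\<close>, where admissibility with
  \<open>\<delta> = - 1 / 2\<close> forces \<open>\<beta> > 1 / 2\<close> and hence \<open>A\<^sub>t\<close> and \<open>B\<^sub>t\<close> both tend to \<open>\<sigma> * \<eta>\<close>. For \<open>\<beta> < 1\<close> the
  variable \<open>S\<^sub>t\<close> tends to \<open>0\<close> in probability and the limit is \<open>1\<close>; for \<open>\<beta> = 1\<close> the law of \<open>S\<^sub>t\<close> is
  constant in \<open>t\<close> and dominated convergence applies.
\<close>

section \<open>The standard normal distribution function\<close>

interpretation std_normal: real_distribution std_normal_distribution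
  by (rule real_dist_normal_dist)

lemma measure_std_normal:
  assumes "A \<in> sets borel"
  shows "measure std_normal_distribution A = (LINT x:A|lborel. std_normal_density x)"
proof -
  have "measure std_normal_distribution A = (\<integral>x. indicator A x \<partial>std_normal_distribution)"
    using assms by (simp add: std_normal.emeasure_finite)
  also have "\<dots> = (\<integral>x. std_normal_density x *\<^sub>R indicator A x \<partial>lborel)"
    using assms by (intro integral_density) (auto simp: normal_density_nonneg)
  finally show ?thesis
    by (simp add: set_lebesgue_integral_def mult.commute)
qed

lemma isCont_std_normal_density [continuous_intros]:
  "isCont std_normal_density x"
  unfolding std_normal_density_def by (intro continuous_intros) auto

text \<open>Passing from the Lebesgue integral over the half-open interval to
  \<open>integral\<close> over the closed one makes the fundamental theorem of calculus
  available.\<close>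

lemma std_normal_cdf_diff:
  assumes "a \<le> b"
  shows "std_normal_cdf b - std_normal_cdf a = integral {a..b} std_normal_density"
proof (cases "a = b")
  case False
  then have "std_normal_cdf b - std_normal_cdf a = (LINT x:{a<..b}|lborel. std_normal_density x)"
    using assms unfolding std_normal_cdf_def
    by (subst std_normal.cdf_diff_eq) (auto simp: measure_std_normal)
  also have "\<dots> = (LINT x:{a..b}|lborel. std_normal_density x)"
    unfolding set_lebesgue_integral_def
    using AE_lborel_singleton[of a]
    by (intro integral_cong_AE) (auto simp: indicator_def elim: eventually_mono)
  also have "\<dots> = integral {a..b} std_normal_density"
    by (intro set_borel_integral_eq_integral borel_integrable_atLeastAtMost')
       (auto intro!: continuous_at_imp_continuous_on continuous_intros)
  finally show ?thesis .
qed simp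

lemma DERIV_std_normal_cdf:
  "(std_normal_cdf has_real_derivative std_normal_density x) (at x)"
proof -
  \<comment> \<open>Any interval with \<open>x\<close> in its interior would serve: near
    \<open>x\<close> the distribution function is a constant plus the integral of the
    density.\<close>
  let ?a = "x - 1" and ?b = "x + 1"
  have "((\<lambda>u. integral {?a..u} std_normal_density) has_real_derivative std_normal_density x)
      (at x within {?a..?b})"
    by (intro integral_has_real_derivative)
       (auto intro!: continuous_at_imp_continuous_on continuous_intros)
  then have "((\<lambda>u. std_normal_cdf ?a + integral {?a..u} std_normal_density)
      has_real_derivative std_normal_density x) (at x)"
    by (subst (asm) at_within_Icc_at) (auto intro!: derivative_eq_intros)
  moreover have "\<forall>\<^sub>F u in nhds x. std_normal_cdf u = std_normal_cdf ?a + integral {?a..u} std_normal_density"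
    using eventually_nhds_in_open[of "{?a<..<?b}" x]
    by (auto elim!: eventually_mono simp flip: std_normal_cdf_diff)
  ultimately show ?thesis
    by (subst DERIV_cong_ev[OF refl _ refl])
qed

lemma DERIV_std_normal_cdf' [derivative_intros]:
  assumes "(f has_real_derivative D) (at x within A)"
  shows "((\<lambda>x. std_normal_cdf (f x)) has_real_derivative std_normal_density (f x) * D) (at x within A)"
  using DERIV_chain2[OF DERIV_std_normal_cdf assms] .

lemma isCont_std_normal_cdf: "isCont std_normal_cdf x"
  using DERIV_std_normal_cdf by (rule DERIV_isCont)

lemma tendsto_std_normal_cdf [tendsto_intros]:
  "(f \<longlongrightarrow> a) F \<Longrightarrow> ((\<lambda>x. std_normal_cdf (f x)) \<longlongrightarrow> std_normal_cdf a) F"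
  by (rule isCont_tendsto_compose[OF isCont_std_normal_cdf])

lemma continuous_on_std_normal_cdf [continuous_intros]:
  "continuous_on A f \<Longrightarrow> continuous_on A (\<lambda>x. std_normal_cdf (f x))"
  using continuous_on_compose2[of UNIV std_normal_cdf A f]
  by (auto intro: continuous_at_imp_continuous_on isCont_std_normal_cdf)

lemma borel_measurable_std_normal_cdf [measurable]: "std_normal_cdf \<in> borel_measurable borel"
  by (intro borel_measurable_continuous_onI continuous_intros)

lemma std_normal_cdf_strict_mono: "x < y \<Longrightarrow> std_normal_cdf x < std_normal_cdf y"
  by (rule DERIV_pos_imp_increasing[of x y std_normal_cdf])
     (auto intro!: DERIV_std_normal_cdf exI normal_density_pos)

lemma std_normal_cdf_mono: "x \<le> y \<Longrightarrow> std_normal_cdf x \<le> std_normal_cdf y"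
  using std_normal_cdf_strict_mono[of x y] by (cases "x = y") auto

lemma std_normal_cdf_nonneg: "0 \<le> std_normal_cdf x"
  and std_normal_cdf_le_1: "std_normal_cdf x \<le> 1"
  unfolding std_normal_cdf_def
  by (auto intro: std_normal.cdf_nonneg std_normal.cdf_bounded_prob)

lemma std_normal_cdf_at_top: "(std_normal_cdf \<longlongrightarrow> 1) at_top"
  and std_normal_cdf_at_bot: "(std_normal_cdf \<longlongrightarrow> 0) at_bot"
  unfolding std_normal_cdf_def by (rule std_normal.cdf_lim_at_top_prob std_normal.cdf_lim_at_bot)+

text \<open>The density is even, so \<open>?F\<close> has derivative zero; its constant value is
  read off at infinity.\<close>

lemma std_normal_cdf_minus: "std_normal_cdf (- x) = 1 - std_normal_cdf x"
proof -
  let ?F = "\<lambda>x. std_normal_cdf x + std_normal_cdf (- x)"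
  have "(?F has_real_derivative 0) (at x)" for x
    by (auto intro!: derivative_eq_intros simp: std_normal_density_def)
  then have const: "?F y = ?F x" for y
    by (intro DERIV_isconst_all) auto
  have "(?F \<longlongrightarrow> 1 + 0) at_top"
    by (intro tendsto_intros std_normal_cdf_at_top
        filterlim_compose[OF std_normal_cdf_at_bot filterlim_uminus_at_bot_at_top])
  moreover have "(?F \<longlongrightarrow> ?F x) at_top"
    by (subst const) (rule tendsto_const)
  ultimately have "?F x = 1 + 0"
    by (intro tendsto_unique) auto
  then show ?thesis by simp
qed

lemma std_normal_cdf_0: "std_normal_cdf 0 = 1 / 2"
  using std_normal_cdf_minus[of 0] by simp

section \<open>Gaussian half-lines, points and exponential moments\<close>

lemma emeasure_std_normal_greaterThan:
  "emeasure std_normal_distribution {- x<..} = ennreal (std_normal_cdf x)"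
proof -
  have "emeasure std_normal_distribution {- x<..} = ennreal (1 - std_normal_cdf (- x))"
    using std_normal.prob_compl[of "{..- x}"]
    by (simp add: std_normal_cdf_def cdf_def std_normal.emeasure_eq_measure Compl_eq_Diff_UNIV[symmetric])
  then show ?thesis by (simp add: std_normal_cdf_minus)
qed

lemma emeasure_std_normal_singleton: "emeasure std_normal_distribution {x} = 0"
  using AE_lborel_singleton[of x]
  by (subst emeasure_density)
     (auto simp: nn_integral_0_iff_AE indicator_def elim: eventually_mono)

lemma nn_integral_std_normal_exp:
  "(\<integral>\<^sup>+z. ennreal (exp (s * z)) \<partial>std_normal_distribution) = ennreal (exp (s\<^sup>2 / 2))"
proof -
  \<comment> \<open>Completing the square shifts the mean to \<open>s\<close>; the shifted density
    has integral one.\<close>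
  have "std_normal_density z * exp (s * z) = exp (s\<^sup>2 / 2) * normal_density s 1 z" for z
    by (simp add: normal_density_def mult_exp_exp[symmetric] exp_add[symmetric])
       (simp add: power2_eq_square field_simps)
  then have "(\<integral>\<^sup>+z. ennreal (exp (s * z)) \<partial>std_normal_distribution)
      = (\<integral>\<^sup>+z. ennreal (exp (s\<^sup>2 / 2)) * ennreal (normal_density s 1 z) \<partial>lborel)"
    by (subst nn_integral_density) (auto simp flip: ennreal_mult)
  also have "\<dots> = ennreal (exp (s\<^sup>2 / 2))"
    by (subst nn_integral_cmult) (auto simp: nn_integral_eq_integral)
  finally show ?thesis .
qed

section \<open>Implicit differentiation of the implied volatility\<close>

lemma DERIV_black_call_vol:
  assumes "0 < v" "0 < t"
  shows "((\<lambda>v. black_call t y v) has_real_derivative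
      sqrt t * std_normal_density (- y / v + v * sqrt t / 2)) (at v)"
proof -
  let ?d1 = "- y / v + v * sqrt t / 2" and ?d2 = "- y / v - v * sqrt t / 2"
  have "- ?d1\<^sup>2 / 2 = y * sqrt t + - ?d2\<^sup>2 / 2"
    using assms by (simp add: power2_eq_square field_simps)
  \<comment> \<open>The densities at \<open>?d1\<close> and \<open>?d2\<close> differ by the factor
    \<open>exp (y * sqrt t)\<close>, since the squares of \<open>?d1\<close> and \<open>?d2\<close>
    differ by \<open>- 2 * y * sqrt t\<close>. Hence the terms with \<open>y / v\<^sup>2\<close>
    cancel and only the vega remains.\<close>
  then have eq: "exp (y * sqrt t) * std_normal_density ?d2 = std_normal_density ?d1"
    unfolding std_normal_density_def by (simp flip: exp_add)
  have "((\<lambda>v. black_call t y v) has_real_derivative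
      std_normal_density ?d1 * (y / v\<^sup>2 + sqrt t / 2)
      - (exp (y * sqrt t) * std_normal_density ?d2) * (y / v\<^sup>2 - sqrt t / 2)) (at v)"
    unfolding black_call_def using assms
    by (auto intro!: derivative_eq_intros simp: power2_eq_square field_simps)
  then show ?thesis
    unfolding eq by (rule DERIV_cong) (simp add: field_simps)
qed

text \<open>The same density identity cancels the two terms that come from differentiating
  \<open>?d1\<close> and \<open>?d2\<close>.\<close>

lemma DERIV_black_call_strike:
  assumes "0 < v" "0 < t"
  shows "((\<lambda>y. black_call t y v) has_real_derivative
      - sqrt t * exp (y * sqrt t) * std_normal_cdf (- y / v - v * sqrt t / 2)) (at y)"
proof -
  let ?d1 = "- y / v + v * sqrt t / 2" and ?d2 = "- y / v - v * sqrt t / 2"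
  have "- ?d1\<^sup>2 / 2 = y * sqrt t + - ?d2\<^sup>2 / 2"
    using assms by (simp add: power2_eq_square field_simps)
  then have eq: "exp (y * sqrt t) * std_normal_density ?d2 = std_normal_density ?d1"
    unfolding std_normal_density_def by (simp flip: exp_add)
  have "((\<lambda>y. black_call t y v) has_real_derivative
      std_normal_density ?d1 * (- 1 / v)
      - (exp (y * sqrt t) * std_normal_density ?d2) * (- 1 / v)
      - sqrt t * exp (y * sqrt t) * std_normal_cdf ?d2) (at y)"
    unfolding black_call_def using assms
    by (auto intro!: derivative_eq_intros simp: field_simps)
  then show ?thesis
    unfolding eq by (rule DERIV_cong) simp
qed

lemma black_call_strict_mono_vol:
  assumes "0 < v" "v < w" "0 < t"
  shows "black_call t y v < black_call t y w"
proof (rule DERIV_pos_imp_increasing[of v w "black_call t y"])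
  fix u assume "v \<le> u" "u \<le> w"
  with assms show "\<exists>d. ((\<lambda>v. black_call t y v) has_real_derivative d) (at u) \<and> 0 < d"
    using DERIV_black_call_vol[of u t y] by (fastforce simp: normal_density_pos)
qed (use assms in auto)

text \<open>Strict monotonicity in the volatility gives the uniqueness that the definite description
  requires.\<close>

lemma implied_vol_eqI:
  assumes "0 < t" "0 < v" "ats_call \<sigma> h M X g t y = black_call t y v"
  shows "implied_vol \<sigma> h M X g t y = v"
  unfolding implied_vol_def
proof (rule the_equality)
  fix w assume "0 < w \<and> ats_call \<sigma> h M X g t y = black_call t y w"
  then show "w = v"
    using assms black_call_strict_mono_vol[of v w t y] black_call_strict_mono_vol[of w v t y]
    by (cases w v rule: linorder_cases) auto
qed (use assms in auto)

text \<open>Implicit differentiation of \<open>C(y) = B(y, I(y))\<close> by the mean value theorem in the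
  volatility. Only \<open>C(0)\<close> is assumed to be an attainable price: strict monotonicity of \<open>B(y, \<cdot>)\<close>
  brackets \<open>I(y)\<close> for small \<open>y\<close>.\<close>

lemma DERIV_implied_vol:
  assumes t: "0 < t" and v0: "0 < v0"
    and C0: "ats_call \<sigma> h M X g t 0 = black_call t 0 v0"
    and C': "((\<lambda>y. ats_call \<sigma> h M X g t y) has_real_derivative - sqrt t * p) (at 0)"
  shows "((\<lambda>y. implied_vol \<sigma> h M X g t y) has_real_derivative
     (std_normal_cdf (- (v0 * sqrt t / 2)) - p) / std_normal_density (v0 * sqrt t / 2)) (at 0)"
proof -
  let ?C = "\<lambda>y. ats_call \<sigma> h M X g t y" and ?B = "\<lambda>y v. black_call t y v"
    and ?I = "\<lambda>y. implied_vol \<sigma> h M X g t y"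
    and ?B' = "\<lambda>y v. sqrt t * std_normal_density (- y / v + v * sqrt t / 2)"
  have contC: "(?C \<longlongrightarrow> ?C 0) (at 0)"
    using DERIV_isCont[OF C'] by (simp add: isCont_def)
  have contB: "((\<lambda>y. ?B y v) \<longlongrightarrow> ?B 0 v) (at 0)" if "0 < v" for v
    using DERIV_isCont[OF DERIV_black_call_strike[OF that t]] by (simp add: isCont_def)
  have near: "\<forall>\<^sub>F y in at 0. \<bar>?I y - v0\<bar> < e \<and> 0 < ?I y \<and> ?C y = ?B y (?I y)"
    if e: "0 < e" "e < v0" for e
  proof -
    have "?B 0 (v0 - e) < ?C 0" "?C 0 < ?B 0 (v0 + e)"
      unfolding C0 using e t v0 by (auto intro!: black_call_strict_mono_vol)
    then have "0 < ?C 0 - ?B 0 (v0 - e)" "0 < ?B 0 (v0 + e) - ?C 0" by simp_all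
    moreover have "((\<lambda>y. ?C y - ?B y (v0 - e)) \<longlongrightarrow> ?C 0 - ?B 0 (v0 - e)) (at 0)"
      "((\<lambda>y. ?B y (v0 + e) - ?C y) \<longlongrightarrow> ?B 0 (v0 + e) - ?C 0) (at 0)"
      using e v0 by (intro tendsto_diff contB contC; simp)+
    ultimately have "\<forall>\<^sub>F y in at 0. 0 < ?C y - ?B y (v0 - e)" "\<forall>\<^sub>F y in at 0. 0 < ?B y (v0 + e) - ?C y"
      by (blast dest: order_tendstoD(1))+
    then show ?thesis
    proof eventually_elim
      case (elim y)
      have "\<exists>v\<ge>v0 - e. v \<le> v0 + e \<and> ?B y v = ?C y"
        using elim e by (intro IVT) (auto intro!: DERIV_isCont DERIV_black_call_vol t)
      then obtain v where v: "v0 - e \<le> v" "v \<le> v0 + e" "?B y v = ?C y" by blast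
      with elim e have "v \<noteq> v0 - e" "v \<noteq> v0 + e" by auto
      with v e implied_vol_eqI[OF t, of v \<sigma> h M X g y] show ?case by auto
    qed
  qed
  have I0: "?I 0 = v0" using t v0 C0 by (rule implied_vol_eqI)
  \<comment> \<open>Mean value theorem in the volatility, on either side of \<open>v0\<close>. The
    intermediate point is then chosen as a function \<open>w\<close> of \<open>y\<close>, and it is
    squeezed to \<open>v0\<close> together with \<open>?I y\<close>.\<close>
  have "\<exists>w. \<bar>w - v0\<bar> \<le> \<bar>?I y - v0\<bar> \<and> ?B y (?I y) - ?B y v0 = (?I y - v0) * ?B' y w"
    if "0 < ?I y" for y
  proof (cases "?I y" v0 rule: linorder_cases)
    case less
    with that have "\<exists>z>?I y. z < v0 \<and> ?B y v0 - ?B y (?I y) = (v0 - ?I y) * ?B' y z"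
      by (intro MVT2 DERIV_black_call_vol t) auto
    then obtain z where "?I y < z" "z < v0" "?B y v0 - ?B y (?I y) = (v0 - ?I y) * ?B' y z" by blast
    then show ?thesis by (intro exI[of _ z]) (auto simp: algebra_simps)
  next
    case greater
    with that v0 have "\<exists>z>v0. z < ?I y \<and> ?B y (?I y) - ?B y v0 = (?I y - v0) * ?B' y z"
      by (intro MVT2 DERIV_black_call_vol t) auto
    then obtain z where "v0 < z" "z < ?I y" "?B y (?I y) - ?B y v0 = (?I y - v0) * ?B' y z" by blast
    then show ?thesis by (intro exI[of _ z]) auto
  qed auto
  then obtain w where w: "\<And>y. 0 < ?I y \<Longrightarrow> \<bar>w y - v0\<bar> \<le> \<bar>?I y - v0\<bar>"
    "\<And>y. 0 < ?I y \<Longrightarrow> ?B y (?I y) - ?B y v0 = (?I y - v0) * ?B' y (w y)"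
    by metis
  have "(w \<longlongrightarrow> v0) (at 0)"
  proof (rule tendstoI)
    fix e :: real assume "0 < e"
    with v0 have "\<forall>\<^sub>F y in at 0. \<bar>?I y - v0\<bar> < min e (v0 / 2) \<and> 0 < ?I y \<and> ?C y = ?B y (?I y)"
      by (intro near) auto
    then show "\<forall>\<^sub>F y in at 0. dist (w y) v0 < e"
      by eventually_elim (use w(1) in \<open>force simp: dist_real_def\<close>)
  qed
  then have "((\<lambda>y. ?B' y (w y)) \<longlongrightarrow> ?B' 0 v0) (at 0)"
    using v0 by (intro tendsto_intros isCont_tendsto_compose[OF isCont_std_normal_density]) auto
  \<comment> \<open>With the volatility frozen at \<open>v0\<close>, this is the difference quotient
    of \<open>?C y - ?B y v0\<close>. Dividing it by the vega at \<open>w y\<close> gives the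
    difference quotient of \<open>?I\<close>.\<close>
  moreover have "((\<lambda>y. (?C y - ?B y v0 - (?C 0 - ?B 0 v0)) / (y - 0)) \<longlongrightarrow>
      - sqrt t * p - (- sqrt t * exp (0 * sqrt t) * std_normal_cdf (- 0 / v0 - v0 * sqrt t / 2))) (at 0)"
    using DERIV_diff[OF C' DERIV_black_call_strike[OF v0 t, of 0]]
    unfolding has_field_derivative_iff .
  ultimately have "((\<lambda>y. (?C y - ?B y v0 - (?C 0 - ?B 0 v0)) / (y - 0) / ?B' y (w y)) \<longlongrightarrow>
      (- sqrt t * p - (- sqrt t * exp (0 * sqrt t) * std_normal_cdf (- 0 / v0 - v0 * sqrt t / 2)))
        / ?B' 0 v0) (at 0)"
    using t by (intro tendsto_divide) (auto simp: normal_density_pos less_imp_neq[symmetric])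
  also have "(- sqrt t * p - (- sqrt t * exp (0 * sqrt t) * std_normal_cdf (- 0 / v0 - v0 * sqrt t / 2)))
        / ?B' 0 v0 = (std_normal_cdf (- (v0 * sqrt t / 2)) - p) / std_normal_density (v0 * sqrt t / 2)"
    using t normal_density_pos[of 1 0 "v0 * sqrt t / 2"] by (simp add: field_simps)
  finally have lim: "((\<lambda>y. (?C y - ?B y v0 - (?C 0 - ?B 0 v0)) / (y - 0) / ?B' y (w y)) \<longlongrightarrow>
     (std_normal_cdf (- (v0 * sqrt t / 2)) - p) / std_normal_density (v0 * sqrt t / 2)) (at 0)" .
  have "\<forall>\<^sub>F y in at 0. \<bar>?I y - v0\<bar> < v0 / 2 \<and> 0 < ?I y \<and> ?C y = ?B y (?I y)"
    using v0 by (intro near) auto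
  then have "\<forall>\<^sub>F y in at 0. (?C y - ?B y v0 - (?C 0 - ?B 0 v0)) / (y - 0) / ?B' y (w y)
      = (?I y - ?I 0) / (y - 0)"
  proof eventually_elim
    case (elim y)
    have "0 < ?B' y (w y)" using t by (simp add: normal_density_pos)
    moreover have "?C y - ?B y v0 - (?C 0 - ?B 0 v0) = (?I y - v0) * ?B' y (w y)"
      using w(2)[of y] elim C0 by simp
    moreover have "a / d / c = b / d" if "0 < c" "a = b * c" for a b c d :: real
      using that by simp
    ultimately show ?case unfolding I0 by blast
  qed
  from Lim_transform_eventually[OF lim this] show ?thesis
    unfolding has_field_derivative_iff .
qed

text \<open>At \<open>y = 0\<close> the Black price is
  \<open>2 * std_normal_cdf (v * sqrt t / 2) - 1\<close>, which by continuity takes every value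
  strictly between \<open>0\<close> and \<open>1\<close> for positive \<open>v\<close>.\<close>

lemma ex_black_vol:
  assumes "0 < t" "0 < c" "c < 1"
  shows "\<exists>v>0. black_call t 0 v = c"
proof -
  have B: "black_call t 0 v = 2 * std_normal_cdf (v * sqrt t / 2) - 1" for v
    by (simp add: black_call_def std_normal_cdf_minus)
  have "\<forall>\<^sub>F x in at_top. (1 + c) / 2 < std_normal_cdf x"
    using assms by (intro order_tendstoD(1)[OF std_normal_cdf_at_top]) auto
  moreover have "\<forall>\<^sub>F x in at_top. (0::real) < x" by (rule eventually_gt_at_top)
  ultimately have "\<forall>\<^sub>F x in at_top. (1 + c) / 2 < std_normal_cdf x \<and> 0 < x"
    by eventually_elim auto
  then obtain x where x: "(1 + c) / 2 < std_normal_cdf x" "0 < x"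
    unfolding eventually_at_top_linorder by blast
  have "\<exists>z\<ge>0. z \<le> x \<and> std_normal_cdf z = (1 + c) / 2"
    using assms x by (intro IVT) (auto simp: std_normal_cdf_0 isCont_std_normal_cdf)
  then obtain z where z: "0 \<le> z" "std_normal_cdf z = (1 + c) / 2" by blast
  with assms have "z \<noteq> 0" by (auto simp: std_normal_cdf_0)
  with z assms show ?thesis
    by (intro exI[of _ "2 * z / sqrt t"]) (auto simp: B)
qed

section \<open>The model at a fixed maturity\<close>

context prob_space
begin

text \<open>Difference quotients of the payoff in the strike are bounded by \<open>1\<close> and
  converge to \<open>- 1\<close> or \<open>0\<close> away from \<open>Z = 1\<close>, a null event by
  \<open>atom\<close>. Dominated convergence gives the derivative at strike \<open>1\<close>, and
  the chain rule passes to the strike \<open>exp (y * r)\<close>.\<close>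

lemma DERIV_expectation_call:
  assumes Z: "integrable M Z" and atom: "AE \<omega> in M. Z \<omega> \<noteq> 1"
  shows "((\<lambda>y. expectation (\<lambda>\<omega>. max 0 (Z \<omega> - exp (y * r)))) has_real_derivative
           - r * prob {\<omega> \<in> space M. 1 < Z \<omega>}) (at 0)"
proof -
  have [measurable]: "Z \<in> borel_measurable M" using Z by auto
  let ?G = "\<lambda>K. expectation (\<lambda>\<omega>. max 0 (Z \<omega> - K))"
  have int: "integrable M (\<lambda>\<omega>. max 0 (Z \<omega> - K))" for K
    using Z by (intro integrable_max) auto
  have "(?G has_real_derivative - prob {\<omega> \<in> space M. 1 < Z \<omega>}) (at 1)"
    unfolding has_field_derivative_iff tendsto_at_iff_sequentially comp_def
  proof (intro allI impI)
    fix K :: "nat \<Rightarrow> real" assume K: "\<forall>i. K i \<in> UNIV - {1}" and lim: "K \<longlonglongrightarrow> 1"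
    let ?q = "\<lambda>n \<omega>. (max 0 (Z \<omega> - K n) - max 0 (Z \<omega> - 1)) / (K n - 1)"
    have "(\<lambda>n. expectation (?q n)) \<longlonglongrightarrow>
        expectation (\<lambda>\<omega>. - indicator {\<omega> \<in> space M. 1 < Z \<omega>} \<omega>)"
    proof (rule integral_dominated_convergence[where w = "\<lambda>_. 1"])
      show "AE \<omega> in M. (\<lambda>n. ?q n \<omega>) \<longlonglongrightarrow> - indicator {\<omega> \<in> space M. 1 < Z \<omega>} \<omega>"
        using atom AE_space
      proof eventually_elim
        case (elim \<omega>)
        show ?case
        proof (cases "1 < Z \<omega>")
          case True
          from order_tendstoD(2)[OF lim this]
          have "\<forall>\<^sub>F n in sequentially. - 1 = ?q n \<omega>"
            by eventually_elim (use True K in \<open>auto simp: field_simps\<close>)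
          from Lim_transform_eventually[OF tendsto_const this] True elim show ?thesis by simp
        next
          case False
          with elim have "Z \<omega> < 1" by simp
          from order_tendstoD(1)[OF lim this]
          have "\<forall>\<^sub>F n in sequentially. 0 = ?q n \<omega>"
            by eventually_elim (use False in auto)
          from Lim_transform_eventually[OF tendsto_const this] False show ?thesis by simp
        qed
      qed
      show "AE \<omega> in M. norm (?q n \<omega>) \<le> 1" for n
      proof (rule AE_I2)
        fix \<omega>
        have "\<bar>max 0 (Z \<omega> - K n) - max 0 (Z \<omega> - 1)\<bar> \<le> \<bar>K n - 1\<bar>" by auto
        moreover have "0 < \<bar>K n - 1\<bar>" using K by auto
        ultimately show "norm (?q n \<omega>) \<le> 1" by (simp add: abs_divide)
      qed
    qed auto
    moreover have "expectation (?q n) = (?G (K n) - ?G 1) / (K n - 1)" for n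
      by (simp only: integral_divide_zero Bochner_Integration.integral_diff[OF int int])
    ultimately show "(\<lambda>n. (?G (K n) - ?G 1) / (K n - 1)) \<longlonglongrightarrow> - prob {\<omega> \<in> space M. 1 < Z \<omega>}"
      by (simp only:) simp
  qed
  then have "(?G has_real_derivative - prob {\<omega> \<in> space M. 1 < Z \<omega>}) (at (exp (0 * r)))"
    by simp
  moreover have "((\<lambda>y. exp (y * r)) has_real_derivative r) (at 0)"
    by (auto intro!: derivative_eq_intros)
  ultimately show ?thesis
    by (rule DERIV_cong[OF DERIV_chain2]) simp
qed

text \<open>Conditioning on \<open>X\<close>: independence makes the joint law a product, and Fubini
  integrates out the Gaussian factor first.\<close>

lemma nn_integral_indep_normal:
  assumes "indep_var borel X borel g" "distributed M lborel g std_normal_density"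
    and [measurable]: "case_prod f \<in> borel_measurable (borel \<Otimes>\<^sub>M borel)"
  shows "(\<integral>\<^sup>+\<omega>. f (X \<omega>) (g \<omega>) \<partial>M) =
       (\<integral>\<^sup>+\<omega>. (\<integral>\<^sup>+z. f (X \<omega>) z \<partial>std_normal_distribution) \<partial>M)"
proof -
  have [measurable]: "X \<in> borel_measurable M" "g \<in> borel_measurable M"
    using assms(1) by (blast dest: indep_var_rv1 indep_var_rv2)+
  have g: "distr M borel g = std_normal_distribution"
    using assms(2) unfolding distributed_def by (simp cong: distr_cong)
  have "(\<integral>\<^sup>+\<omega>. f (X \<omega>) (g \<omega>) \<partial>M)
      = (\<integral>\<^sup>+p. case_prod f p \<partial>distr M (borel \<Otimes>\<^sub>M borel) (\<lambda>\<omega>. (X \<omega>, g \<omega>)))"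
    by (subst nn_integral_distr) auto
  also have "distr M (borel \<Otimes>\<^sub>M borel) (\<lambda>\<omega>. (X \<omega>, g \<omega>)) = distr M borel X \<Otimes>\<^sub>M std_normal_distribution"
    using assms(1) unfolding indep_var_distribution_eq g by simp
  also have "(\<integral>\<^sup>+p. case_prod f p \<partial>(distr M borel X \<Otimes>\<^sub>M std_normal_distribution))
      = (\<integral>\<^sup>+x. (\<integral>\<^sup>+z. f x z \<partial>std_normal_distribution) \<partial>distr M borel X)"
    by (subst std_normal.nn_integral_fst[symmetric]) (auto cong: measurable_cong_sets)
  also have "\<dots> = (\<integral>\<^sup>+\<omega>. (\<integral>\<^sup>+z. f (X \<omega>) z \<partial>std_normal_distribution) \<partial>M)"
    by (subst nn_integral_distr) auto
  finally show ?thesis .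
qed

end

section \<open>Prices, exercise probability and skew at one maturity\<close>

locale ats_maturity = prob_space M for M :: "'a measure" +
  fixes X g :: "'a \<Rightarrow> real" and \<sigma> h t :: real
  assumes X [measurable]: "X \<in> borel_measurable M"
    and X_pos: "AE \<omega> in M. 0 < X \<omega>"
    and g: "distributed M lborel g std_normal_density"
    and indep: "indep_var borel X borel g"
    and pos: "0 < \<sigma>" "0 < h" "0 < t"
begin

abbreviation "L \<equiv> laplace_transform M X"
abbreviation "f \<equiv> ats_forward \<sigma> h M X g t"
abbreviation "\<phi> \<equiv> ats_phi \<sigma> h M X t"

lemma g_measurable [measurable]: "g \<in> borel_measurable M"
  using indep by (blast dest: indep_var_rv2)

lemma f_measurable [measurable]: "f \<in> borel_measurable M"
  unfolding ats_forward_def by measurable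

lemma integrable_exp_neg: "0 \<le> u \<Longrightarrow> integrable M (\<lambda>\<omega>. exp (- u * X \<omega>))"
  using X_pos by (intro integrable_const_bound[of _ 1]) (auto elim!: eventually_mono)

lemma laplace_le_1:
  assumes "0 \<le> u" shows "L u \<le> 1"
proof -
  have "L u \<le> expectation (\<lambda>_. 1)"
    unfolding laplace_transform_def using X_pos assms
    by (intro integral_mono_AE integrable_exp_neg) (auto elim!: eventually_mono)
  then show ?thesis by (simp add: prob_space)
qed

lemma laplace_pos:
  assumes "0 \<le> u" shows "0 < L u"
proof -
  have "expectation (\<lambda>_. 0) < L u"
    unfolding laplace_transform_def using integrable_exp_neg[OF assms]
    by (intro integral_less_AE_space) (auto simp: emeasure_space_1)
  then show ?thesis by simp
qed

lemma forward_exponent_nonneg: "0 \<le> \<phi> * t"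
  using laplace_le_1[of "t * \<sigma>\<^sup>2 * h"] laplace_pos[of "t * \<sigma>\<^sup>2 * h"] pos
  by (simp add: ats_phi_def)

text \<open>Integrating out \<open>g\<close> adds half the conditional variance and leaves
  \<open>exp (\<phi> * t) * exp (- (t * \<sigma>\<^sup>2 * h) * X \<omega>)\<close>;
  \<open>\<phi>\<close> is defined so that the mean of this is \<open>1\<close>.\<close>

lemma nn_integral_exp_forward: "(\<integral>\<^sup>+\<omega>. ennreal (exp (f \<omega>)) \<partial>M) = 1"
proof -
  let ?m = "\<lambda>x. - (h + 1 / 2) * \<sigma>\<^sup>2 * x * t + \<phi> * t" and ?s = "\<lambda>x. \<sigma> * sqrt (x * t)"
  have "(\<integral>\<^sup>+\<omega>. ennreal (exp (f \<omega>)) \<partial>M)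
      = (\<integral>\<^sup>+\<omega>. (\<integral>\<^sup>+z. ennreal (exp (?m (X \<omega>) + ?s (X \<omega>) * z)) \<partial>std_normal_distribution) \<partial>M)"
    by (subst nn_integral_indep_normal[OF indep g, symmetric])
       (auto simp: ats_forward_def algebra_simps)
  also have "\<dots> = (\<integral>\<^sup>+\<omega>. ennreal (exp (\<phi> * t)) * ennreal (exp (- (t * \<sigma>\<^sup>2 * h) * X \<omega>)) \<partial>M)"
  proof (rule nn_integral_cong_AE, use X_pos in eventually_elim)
    case (elim \<omega>)
    have "(\<integral>\<^sup>+z. ennreal (exp (?m (X \<omega>) + ?s (X \<omega>) * z)) \<partial>std_normal_distribution)
        = ennreal (exp (?m (X \<omega>))) * ennreal (exp ((?s (X \<omega>))\<^sup>2 / 2))"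
      by (subst nn_integral_std_normal_exp[symmetric], subst nn_integral_cmult[symmetric])
         (auto simp: exp_add ennreal_mult)
    also have "\<dots> = ennreal (exp (\<phi> * t)) * ennreal (exp (- (t * \<sigma>\<^sup>2 * h) * X \<omega>))"
      using elim pos by (simp add: power_mult_distrib algebra_simps flip: ennreal_mult exp_add)
    finally show ?case .
  qed
  also have "\<dots> = ennreal (exp (\<phi> * t)) * ennreal (L (t * \<sigma>\<^sup>2 * h))"
    unfolding laplace_transform_def using integrable_exp_neg[of "t * \<sigma>\<^sup>2 * h"] pos
    by (subst nn_integral_cmult) (auto simp: nn_integral_eq_integral)
  also have "\<dots> = 1"
    using laplace_pos[of "t * \<sigma>\<^sup>2 * h"] pos
    by (simp add: ats_phi_def exp_minus flip: ennreal_mult)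
  finally show ?thesis .
qed

lemma integrable_exp_forward: "integrable M (\<lambda>\<omega>. exp (f \<omega>))"
  and expectation_exp_forward: "expectation (\<lambda>\<omega>. exp (f \<omega>)) = 1"
proof -
  show "integrable M (\<lambda>\<omega>. exp (f \<omega>))"
    by (rule integrableI_nonneg) (auto simp: nn_integral_exp_forward)
  show "expectation (\<lambda>\<omega>. exp (f \<omega>)) = 1"
    by (subst integral_eq_nn_integral) (auto simp: nn_integral_exp_forward)
qed

text \<open>Given \<open>X > 0\<close>, the exponent is affine in \<open>g\<close> with nonzero
  slope, and the normal law has no atoms. This is what makes the call price differentiable at the
  money.\<close>

lemma forward_eq_0_null: "AE \<omega> in M. f \<omega> \<noteq> 0"
proof -
  let ?F = "\<lambda>x z. - (h + 1 / 2) * \<sigma>\<^sup>2 * x * t + \<sigma> * sqrt (x * t) * z + \<phi> * t"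
  have "(\<integral>\<^sup>+\<omega>. indicator {0} (f \<omega>) \<partial>M)
      = (\<integral>\<^sup>+\<omega>. (\<integral>\<^sup>+z. indicator {0} (?F (X \<omega>) z) \<partial>std_normal_distribution) \<partial>M)"
    by (subst nn_integral_indep_normal[OF indep g, symmetric])
       (auto simp: ats_forward_def)
  also have "\<dots> = (\<integral>\<^sup>+\<omega>. 0 \<partial>M)"
  proof (rule nn_integral_cong_AE, use X_pos in eventually_elim)
    case (elim \<omega>)
    let ?z = "((h + 1 / 2) * \<sigma>\<^sup>2 * X \<omega> * t - \<phi> * t) / (\<sigma> * sqrt (X \<omega> * t))"
    have "?F (X \<omega>) z = 0 \<longleftrightarrow> z = ?z" for z
      using elim pos by (auto simp: field_simps)
    then have "(\<integral>\<^sup>+z. indicator {0} (?F (X \<omega>) z) \<partial>std_normal_distribution)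
        = (\<integral>\<^sup>+z. indicator {?z} z \<partial>std_normal_distribution)"
      by (intro nn_integral_cong) (auto simp: indicator_def)
    then show ?case
      by (simp add: emeasure_std_normal_singleton)
  qed
  finally have "(\<integral>\<^sup>+\<omega>. indicator {0} (f \<omega>) \<partial>M) = 0" by simp
  then have "AE \<omega> in M. indicator {0} (f \<omega>) = (0::ennreal)"
    by (subst (asm) nn_integral_0_iff_AE) auto
  then show ?thesis by (auto elim!: eventually_mono split: split_indicator_asm)
qed

lemma prob_forward_pos:
  "prob {\<omega> \<in> space M. 0 < f \<omega>} = expectation (\<lambda>\<omega>. std_normal_cdf
      (\<phi> * sqrt t / \<sigma> / sqrt (X \<omega>) - (h + 1 / 2) * \<sigma> * sqrt t * sqrt (X \<omega>)))"
proof -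
  let ?F = "\<lambda>x z. - (h + 1 / 2) * \<sigma>\<^sup>2 * x * t + \<sigma> * sqrt (x * t) * z + \<phi> * t"
  let ?d = "\<lambda>x. \<phi> * sqrt t / \<sigma> / sqrt x - (h + 1 / 2) * \<sigma> * sqrt t * sqrt x"
  have "emeasure M {\<omega> \<in> space M. 0 < f \<omega>} = (\<integral>\<^sup>+\<omega>. indicator {0<..} (f \<omega>) \<partial>M)"
  proof -
    have "(\<integral>\<^sup>+\<omega>. indicator {0<..} (f \<omega>) \<partial>M) = (\<integral>\<^sup>+\<omega>. indicator {\<omega> \<in> space M. 0 < f \<omega>} \<omega> \<partial>M)"
      by (intro nn_integral_cong) (auto split: split_indicator)
    then show ?thesis by simp
  qed
  also have "\<dots> = (\<integral>\<^sup>+\<omega>. (\<integral>\<^sup>+z. indicator {0<..} (?F (X \<omega>) z) \<partial>std_normal_distribution) \<partial>M)"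
    by (subst nn_integral_indep_normal[OF indep g, symmetric])
       (auto simp: ats_forward_def)
  also have "\<dots> = (\<integral>\<^sup>+\<omega>. ennreal (std_normal_cdf (?d (X \<omega>))) \<partial>M)"
  proof (rule nn_integral_cong_AE, use X_pos in eventually_elim)
    case (elim \<omega>)
    let ?s = "\<sigma> * sqrt (X \<omega> * t)"
    have "0 < ?s" using elim pos by simp
    \<comment> \<open>Factoring out the positive conditional deviation \<open>?s\<close> turns
      \<open>0 < f\<close> into the event that \<open>g\<close> exceeds \<open>- ?d\<close>.\<close>
    moreover have "?F (X \<omega>) z = ?s * (z + ?d (X \<omega>))" for z
    proof -
      have "sqrt (X \<omega> * t) * (\<phi> * sqrt t / \<sigma> / sqrt (X \<omega>)) = \<phi> * t / \<sigma>"
        using elim pos by (simp add: real_sqrt_mult)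
      moreover have "sqrt (X \<omega> * t) * ((h + 1 / 2) * \<sigma> * sqrt t * sqrt (X \<omega>))
          = (h + 1 / 2) * \<sigma> * (sqrt (X \<omega> * t) * sqrt (X \<omega> * t))"
        by (simp only: real_sqrt_mult ac_simps)
      then have "sqrt (X \<omega> * t) * ((h + 1 / 2) * \<sigma> * sqrt t * sqrt (X \<omega>)) = (h + 1 / 2) * \<sigma> * X \<omega> * t"
        using elim pos by simp
      ultimately have "\<sigma> * (sqrt (X \<omega> * t) * ?d (X \<omega>)) = \<phi> * t - (h + 1 / 2) * \<sigma>\<^sup>2 * X \<omega> * t"
        using pos by (simp add: right_diff_distrib power2_eq_square)
      then show ?thesis by (simp add: algebra_simps)
    qed
    moreover have "0 < s * (z + d) \<longleftrightarrow> - d < z" if "0 < s" for s z d :: real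
      using that by (auto simp: zero_less_mult_iff)
    ultimately have "0 < ?F (X \<omega>) z \<longleftrightarrow> - ?d (X \<omega>) < z" for z
      by presburger
    then have "(\<integral>\<^sup>+z. indicator {0<..} (?F (X \<omega>) z) \<partial>std_normal_distribution)
        = (\<integral>\<^sup>+z. indicator {- ?d (X \<omega>)<..} z \<partial>std_normal_distribution)"
      by (intro nn_integral_cong) (auto simp: indicator_def)
    also have "\<dots> = emeasure std_normal_distribution {- ?d (X \<omega>)<..}"
      by (rule nn_integral_indicator) simp
    also have "\<dots> = ennreal (std_normal_cdf (?d (X \<omega>)))"
      by (rule emeasure_std_normal_greaterThan)
    finally show ?case .
  qed
  also have "\<dots> = ennreal (expectation (\<lambda>\<omega>. std_normal_cdf (?d (X \<omega>))))"
    by (intro nn_integral_eq_integral integrable_const_bound[of _ 1])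
       (auto simp: std_normal_cdf_nonneg std_normal_cdf_le_1)
  finally show ?thesis
    by (simp add: emeasure_eq_measure integral_nonneg_AE std_normal_cdf_nonneg)
qed

text \<open>Put-call parity at the money, from
  \<open>max 0 (x - 1) = max 0 (1 - x) + (x - 1)\<close> and the unit mean of
  \<open>exp (f \<omega>)\<close>.\<close>

lemma call_eq_put: "ats_call \<sigma> h M X g t 0 = expectation (\<lambda>\<omega>. max 0 (1 - exp (f \<omega>)))"
proof -
  have "ats_call \<sigma> h M X g t 0 = expectation (\<lambda>\<omega>. max 0 (1 - exp (f \<omega>)) + (exp (f \<omega>) - 1))"
    unfolding ats_call_def by (intro Bochner_Integration.integral_cong) auto
  also have "\<dots> = expectation (\<lambda>\<omega>. max 0 (1 - exp (f \<omega>))) + (expectation (\<lambda>\<omega>. exp (f \<omega>)) - 1)"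
    using integrable_exp_forward by (simp add: prob_space)
  finally show ?thesis by (simp add: expectation_exp_forward)
qed

text \<open>A vanishing call price makes the put price vanish by parity, so \<open>f = 0\<close>
  almost surely, which contradicts \<open>forward_eq_0_null\<close>.\<close>

lemma call_pos: "0 < ats_call \<sigma> h M X g t 0"
proof (rule ccontr)
  have nonneg: "0 \<le> ats_call \<sigma> h M X g t 0"
    unfolding ats_call_def by (intro integral_nonneg_AE) auto
  assume "\<not> ?thesis"
  with nonneg have "ats_call \<sigma> h M X g t 0 = 0" by simp
  then have "expectation (\<lambda>\<omega>. max 0 (exp (f \<omega>) - 1)) = 0" "expectation (\<lambda>\<omega>. max 0 (1 - exp (f \<omega>))) = 0"
    by (simp_all add: ats_call_def flip: call_eq_put)
  moreover have "AE \<omega> in M. Z \<omega> = 0" if "integrable M Z" "\<And>\<omega>. 0 \<le> Z \<omega>" "expectation Z = 0" for Z :: "'a \<Rightarrow> real"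
    using integral_nonneg_eq_0_iff_AE[of M Z] that by simp
  ultimately have "AE \<omega> in M. max 0 (exp (f \<omega>) - 1) = 0" "AE \<omega> in M. max 0 (1 - exp (f \<omega>)) = 0"
    using integrable_exp_forward by simp_all
  with forward_eq_0_null have "AE \<omega> in M. False"
    by eventually_elim (auto simp: max_def split: if_splits)
  then show False by (simp add: AE_False)
qed

lemma call_less_1: "ats_call \<sigma> h M X g t 0 < 1"
proof -
  have "expectation (\<lambda>\<omega>. max 0 (1 - exp (f \<omega>))) < expectation (\<lambda>_. 1)"
    using integrable_exp_forward
    by (intro integral_less_AE_space) (auto simp: emeasure_space_1)
  then show ?thesis by (simp add: call_eq_put prob_space)
qed

text \<open>Here \<open>a\<close> is half the at-the-money total volatility,
  \<open>v * sqrt t / 2\<close>. Its relation to the call price is recorded because it later forces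
  \<open>a\<close> to tend to \<open>0\<close>.\<close>

lemma skew_eq:
  obtains a where "0 < a" "std_normal_cdf a - std_normal_cdf (- a) = ats_call \<sigma> h M X g t 0"
    "deriv (implied_vol \<sigma> h M X g t) 0 =
       (std_normal_cdf (- a) - prob {\<omega> \<in> space M. 0 < f \<omega>}) / std_normal_density a"
proof -
  obtain v where v: "0 < v" "black_call t 0 v = ats_call \<sigma> h M X g t 0"
    using ex_black_vol[OF pos(3) call_pos call_less_1] by blast
  have "((\<lambda>y. expectation (\<lambda>\<omega>. max 0 (exp (f \<omega>) - exp (y * sqrt t)))) has_real_derivative
      - sqrt t * prob {\<omega> \<in> space M. 1 < exp (f \<omega>)}) (at 0)"
    using forward_eq_0_null by (intro DERIV_expectation_call integrable_exp_forward) auto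
  then have "((\<lambda>y. ats_call \<sigma> h M X g t y) has_real_derivative
      - sqrt t * prob {\<omega> \<in> space M. 0 < f \<omega>}) (at 0)"
    by (simp add: ats_call_def[abs_def])
  from DERIV_imp_deriv[OF DERIV_implied_vol[OF pos(3) v(1) v(2)[symmetric] this]] v pos
  show ?thesis
    by (intro that[of "v * sqrt t / 2"]) (auto simp: black_call_def)
qed

lemma call_le:
  assumes int: "integrable M X" and le: "expectation X \<le> 1"
  shows "ats_call \<sigma> h M X g t 0 \<le> (h + 1 / 2) * \<sigma>\<^sup>2 * t + \<sigma> * sqrt t"
proof -
  have g2: "integrable M (\<lambda>\<omega>. (g \<omega>)\<^sup>2)" "expectation (\<lambda>\<omega>. (g \<omega>)\<^sup>2) = 1"
  proof -
    show "integrable M (\<lambda>\<omega>. (g \<omega>)\<^sup>2)"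
      using integrable_std_normal_moment[of 2]
      by (subst distributed_integrable[OF g, symmetric]) (auto simp: normal_density_nonneg)
    show "expectation (\<lambda>\<omega>. (g \<omega>)\<^sup>2) = 1"
      using integral_std_normal_moment_even[of 1]
      by (subst distributed_integral[OF g, symmetric]) (auto simp: normal_density_nonneg)
  qed
  have "ats_call \<sigma> h M X g t 0
      \<le> expectation (\<lambda>\<omega>. (h + 1 / 2) * \<sigma>\<^sup>2 * t * X \<omega> + \<sigma> * sqrt t * ((X \<omega> + (g \<omega>)\<^sup>2) / 2))"
    unfolding call_eq_put
  proof (rule integral_mono_AE)
    show "AE \<omega> in M. max 0 (1 - exp (f \<omega>))
        \<le> (h + 1 / 2) * \<sigma>\<^sup>2 * t * X \<omega> + \<sigma> * sqrt t * ((X \<omega> + (g \<omega>)\<^sup>2) / 2)"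
      using X_pos
    proof eventually_elim
      case (elim \<omega>)
      have "0 \<le> (sqrt (X \<omega>) + g \<omega>)\<^sup>2" by simp
      then have "- sqrt (X \<omega>) * g \<omega> \<le> (X \<omega> + (g \<omega>)\<^sup>2) / 2"
        using elim by (simp add: power2_sum)
      then have "\<sigma> * sqrt t * (- sqrt (X \<omega>) * g \<omega>) \<le> \<sigma> * sqrt t * ((X \<omega> + (g \<omega>)\<^sup>2) / 2)"
        using pos by (intro mult_left_mono) auto
      moreover have "- f \<omega> = (h + 1 / 2) * \<sigma>\<^sup>2 * t * X \<omega> + \<sigma> * sqrt t * (- sqrt (X \<omega>) * g \<omega>) - \<phi> * t"
        by (simp add: ats_forward_def real_sqrt_mult) (simp add: field_simps)
      ultimately have "- f \<omega> \<le> (h + 1 / 2) * \<sigma>\<^sup>2 * t * X \<omega> + \<sigma> * sqrt t * ((X \<omega> + (g \<omega>)\<^sup>2) / 2)"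
        using forward_exponent_nonneg by linarith
      moreover have "1 - exp (f \<omega>) \<le> - f \<omega>" using exp_ge_add_one_self[of "f \<omega>"] by linarith
      moreover have "0 \<le> (h + 1 / 2) * \<sigma>\<^sup>2 * t * X \<omega> + \<sigma> * sqrt t * ((X \<omega> + (g \<omega>)\<^sup>2) / 2)"
        using elim pos by (intro add_nonneg_nonneg mult_nonneg_nonneg) auto
      ultimately show ?case by linarith
    qed
  qed (use int g2 integrable_exp_forward in auto)
  also have "\<dots> = (h + 1 / 2) * \<sigma>\<^sup>2 * t * expectation X + \<sigma> * sqrt t * ((expectation X + 1) / 2)"
    using int g2 by simp
  also have "\<dots> \<le> (h + 1 / 2) * \<sigma>\<^sup>2 * t * 1 + \<sigma> * sqrt t * ((1 + 1) / 2)"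
    using le pos by (intro add_mono mult_left_mono divide_right_mono) auto
  finally show ?thesis by simp
qed

text \<open>Fatou's lemma for \<open>(1 - exp (- u * X)) / u\<close> along
  \<open>u = 1 / (n + 1)\<close>. The mean of this quotient is \<open>(1 - L u) / u\<close>, which
  is at most \<open>1\<close> because \<open>L u \<ge> 1 + ln (L u) \<ge> 1 - u\<close>.\<close>

lemma
  assumes lower: "\<And>u. 0 \<le> u \<Longrightarrow> - u \<le> ln (L u)"
  shows integrable_of_laplace: "integrable M X" and expectation_le_of_laplace: "expectation X \<le> 1"
proof -
  let ?q = "\<lambda>n \<omega>. (1 - exp (- (1 / real (Suc n)) * X \<omega>)) / (1 / real (Suc n))"
  have "(\<integral>\<^sup>+\<omega>. ennreal (X \<omega>) \<partial>M) = (\<integral>\<^sup>+\<omega>. liminf (\<lambda>n. ennreal (?q n \<omega>)) \<partial>M)"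
  proof (intro nn_integral_cong)
    fix \<omega>
    have "((\<lambda>u. (1 - exp (- u * X \<omega>)) / u) \<longlongrightarrow> X \<omega>) (at 0)"
    proof -
      have "((\<lambda>u. 1 - exp (- u * X \<omega>)) has_real_derivative X \<omega>) (at 0)"
        by (auto intro!: derivative_eq_intros)
      then show ?thesis by (simp add: has_field_derivative_iff)
    qed
    then have "(\<lambda>n. ?q n \<omega>) \<longlonglongrightarrow> X \<omega>"
      using LIMSEQ_inverse_real_of_nat
      by (elim filterlim_compose) (auto simp: filterlim_at inverse_eq_divide)
    then have "(\<lambda>n. ennreal (?q n \<omega>)) \<longlonglongrightarrow> ennreal (X \<omega>)" by (rule tendsto_ennrealI)
    then show "ennreal (X \<omega>) = liminf (\<lambda>n. ennreal (?q n \<omega>))"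
      by (simp add: lim_imp_Liminf)
  qed
  also have "\<dots> \<le> liminf (\<lambda>n. \<integral>\<^sup>+\<omega>. ennreal (?q n \<omega>) \<partial>M)"
    by (intro nn_integral_liminf) auto
  also have "\<dots> \<le> 1"
  proof (rule Liminf_le)
    show "\<forall>\<^sub>F n in sequentially. (\<integral>\<^sup>+\<omega>. ennreal (?q n \<omega>) \<partial>M) \<le> 1"
    proof (rule always_eventually, rule allI)
      fix n
      let ?u = "1 / real (Suc n)"
      have u: "0 \<le> ?u" by simp
      have "(\<integral>\<^sup>+\<omega>. ennreal (?q n \<omega>) \<partial>M) = ennreal (expectation (?q n))"
        using X_pos integrable_exp_neg[of ?u]
        by (intro nn_integral_eq_integral) (auto elim!: eventually_mono)
      also have "expectation (?q n) = (1 - L ?u) / ?u"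
        using integrable_exp_neg[of ?u] by (simp add: laplace_transform_def prob_space)
      also have "\<dots> \<le> 1"
      proof -
        have "1 - L ?u \<le> ?u"
          using lower[OF u] laplace_pos[OF u] ln_le_minus_one[of "L ?u"] by linarith
        then show ?thesis by (subst divide_le_eq_1_pos) auto
      qed
      finally show "(\<integral>\<^sup>+\<omega>. ennreal (?q n \<omega>) \<partial>M) \<le> 1" by (simp only: ennreal_leI ennreal_1)
    qed
  qed auto
  finally have le: "(\<integral>\<^sup>+\<omega>. ennreal (X \<omega>) \<partial>M) \<le> 1" .
  have nonneg: "AE \<omega> in M. 0 \<le> X \<omega>" using X_pos by (auto elim: eventually_mono)
  show int: "integrable M X"
    using le nonneg by (intro integrableI_nonneg) (auto intro: le_less_trans)
  show "expectation X \<le> 1"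
    using le nonneg int by (simp add: nn_integral_eq_integral)
qed

end

section \<open>Laplace transforms and small-maturity limits\<close>

lemma (in prob_space) expectation_polynomial_exp:
  assumes [measurable]: "X \<in> borel_measurable M" and pos: "AE \<omega> in M. 0 < X \<omega>"
  shows "integrable M (\<lambda>\<omega>. \<Sum>i\<le>n. a i * exp (- X \<omega>) ^ i)"
    and "expectation (\<lambda>\<omega>. \<Sum>i\<le>n. a i * exp (- X \<omega>) ^ i)
      = (\<Sum>i\<le>n. a i * laplace_transform M X (real i))"
proof -
  have int: "integrable M (\<lambda>\<omega>. exp (- X \<omega>) ^ i)" for i
    using pos by (intro integrable_const_bound[of _ 1]) (auto elim!: eventually_mono intro: power_le_one)
  then show "integrable M (\<lambda>\<omega>. \<Sum>i\<le>n. a i * exp (- X \<omega>) ^ i)"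
    by (intro Bochner_Integration.integrable_sum integrable_mult_right)
  show "expectation (\<lambda>\<omega>. \<Sum>i\<le>n. a i * exp (- X \<omega>) ^ i)
      = (\<Sum>i\<le>n. a i * laplace_transform M X (real i))"
    using int
    by (subst Bochner_Integration.integral_sum)
       (auto simp: laplace_transform_def simp flip: exp_of_nat_mult)
qed

text \<open>Uniqueness of Laplace transforms: \<open>w = exp (- x)\<close> turns \<open>h\<close> into a continuous function on
  \<open>[0, 1]\<close>, and the transform at the integers gives the moments of \<open>exp (- X)\<close>.\<close>

lemma expectation_eq_of_laplace_eq:
  fixes h :: "real \<Rightarrow> real"
  assumes M: "prob_space M" "X \<in> borel_measurable M" "AE \<omega> in M. 0 < X \<omega>"
    and N: "prob_space N" "Y \<in> borel_measurable N" "AE \<omega> in N. 0 < Y \<omega>"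
    and L: "\<And>n::nat. laplace_transform M X (real n) = laplace_transform N Y (real n)"
    and meas [measurable]: "h \<in> borel_measurable borel"
    and cont: "continuous_on {0<..} h"
    and lim0: "(h \<longlongrightarrow> A) (at_right 0)" and lim_inf: "(h \<longlongrightarrow> B) at_top"
  shows "(\<integral>\<omega>. h (X \<omega>) \<partial>M) = (\<integral>\<omega>. h (Y \<omega>) \<partial>N)"
proof -
  \<comment> \<open>The endpoint \<open>w = 0\<close> corresponds to \<open>x\<close> at infinity
    and \<open>w = 1\<close> to \<open>x = 0\<close>, so the two limits of \<open>h\<close> supply
    the boundary values.\<close>
  define q where "q = (\<lambda>w::real. if w \<le> 0 then B else if 1 \<le> w then A else h (- ln w))"
  have q_exp: "q (exp (- x)) = h x" if "0 < x" for x using that by (simp add: q_def)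
  have "continuous_on {0..1} q"
    unfolding continuous_on_def
  proof
    fix w :: real assume w: "w \<in> {0..1}"
    consider "w = 0" | "w = 1" | "0 < w" "w < 1" using w by fastforce
    then show "(q \<longlongrightarrow> q w) (at w within {0..1})"
    proof cases
      case 1
      have "((\<lambda>w. h (- ln w)) \<longlongrightarrow> B) (at_right 0)"
        by (rule filterlim_compose[OF lim_inf]) real_asymp
      moreover have "\<forall>\<^sub>F w in at_right 0. h (- ln w) = q w"
        using eventually_at_right_real[of 0 1] by (auto elim!: eventually_mono simp: q_def)
      ultimately have "(q \<longlongrightarrow> B) (at_right 0)" by (rule Lim_transform_eventually)
      then show ?thesis using 1 by (simp add: q_def at_within_Icc_at_right)
    next
      case 2
      have "((\<lambda>w. h (- ln w)) \<longlongrightarrow> A) (at_left 1)"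
        by (rule filterlim_compose[OF lim0]) real_asymp
      moreover have "\<forall>\<^sub>F w in at_left 1. h (- ln w) = q w"
        using eventually_at_left_real[of 0 1] by (auto elim!: eventually_mono simp: q_def)
      ultimately have "(q \<longlongrightarrow> A) (at_left 1)" by (rule Lim_transform_eventually)
      then show ?thesis using 2 by (simp add: q_def at_within_Icc_at_left)
    next
      case 3
      have "isCont h (- ln w)"
        using cont 3 by (simp add: continuous_on_eq_continuous_at)
      moreover have "((\<lambda>w. - ln w) \<longlongrightarrow> - ln w) (at w)"
        using 3 by (intro tendsto_intros) auto
      ultimately have "((\<lambda>w. h (- ln w)) \<longlongrightarrow> h (- ln w)) (at w)"
        by (rule isCont_tendsto_compose)
      moreover have "\<forall>\<^sub>F w in at w. h (- ln w) = q w"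
        using eventually_at_in_open'[of "{0<..<1}" w] 3
        by (auto elim!: eventually_mono simp: q_def)
      ultimately have "(q \<longlongrightarrow> h (- ln w)) (at w)" by (rule Lim_transform_eventually)
      then show ?thesis using 3 by (simp add: q_def at_within_Icc_at)
    qed
  qed
  note q_cont = this
  have "bounded (q ` {0..1})"
    by (intro compact_imp_bounded compact_continuous_image q_cont) auto
  then obtain K where K: "\<And>w. w \<in> {0..1} \<Longrightarrow> \<bar>q w\<bar> \<le> K"
    unfolding bounded_iff by fastforce
  \<comment> \<open>Stated for an arbitrary space, so that it serves both \<open>X\<close> and
    \<open>Y\<close>: a polynomial uniformly close to \<open>q\<close> brings the mean of
    \<open>h\<close> close to a number that depends on the transform alone.\<close>
  have approx: "\<bar>(\<integral>\<omega>. h (Z \<omega>) \<partial>P) - (\<Sum>i\<le>n. a i * laplace_transform P Z (real i))\<bar> \<le> e"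
    if P: "prob_space P" "Z \<in> borel_measurable P" "AE \<omega> in P. 0 < Z \<omega>"
      and a: "\<And>w. w \<in> {0..1} \<Longrightarrow> \<bar>q w - (\<Sum>i\<le>n. a i * w ^ i)\<bar> < e"
    for P :: "'c measure" and Z a n e
  proof -
    interpret P: prob_space P by fact
    note [measurable] = P(2)
    let ?p = "\<lambda>\<omega>. \<Sum>i\<le>n. a i * exp (- Z \<omega>) ^ i"
    have int: "integrable P (\<lambda>\<omega>. h (Z \<omega>))"
    proof (rule P.integrable_const_bound[of _ K])
      show "AE \<omega> in P. norm (h (Z \<omega>)) \<le> K"
        using P(3)
      proof eventually_elim
        case (elim \<omega>)
        with K[of "exp (- Z \<omega>)"] show ?case by (simp add: q_exp)
      qed
    qed simp
    note p = P.expectation_polynomial_exp[OF P(2,3), of a n]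
    have "\<bar>(\<integral>\<omega>. h (Z \<omega>) \<partial>P) - (\<integral>\<omega>. ?p \<omega> \<partial>P)\<bar> = \<bar>\<integral>\<omega>. h (Z \<omega>) - ?p \<omega> \<partial>P\<bar>"
      using int p(1) by (subst Bochner_Integration.integral_diff) auto
    also have "\<dots> \<le> (\<integral>\<omega>. \<bar>h (Z \<omega>) - ?p \<omega>\<bar> \<partial>P)" by (rule integral_abs_bound)
    also have "\<dots> \<le> (\<integral>\<omega>. e \<partial>P)"
    proof (rule integral_mono_AE)
      show "AE \<omega> in P. \<bar>h (Z \<omega>) - ?p \<omega>\<bar> \<le> e"
        using P(3)
      proof eventually_elim
        case (elim \<omega>)
        with a[of "exp (- Z \<omega>)"] show ?case by (simp add: q_exp)
      qed
    qed (use int p(1) in auto)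
    finally show ?thesis using p(2) by (simp add: P.prob_space)
  qed
  have "dist (\<integral>\<omega>. h (X \<omega>) \<partial>M) (\<integral>\<omega>. h (Y \<omega>) \<partial>N) \<le> e" if "0 < e" for e
  proof -
    \<comment> \<open>Both means lie within \<open>e / 2\<close> of the same combination of
      transform values.\<close>
    from that have "0 < e / 2" by simp
    from Stone_Weierstrass_real_polynomial_function[OF compact_Icc q_cont this]
    obtain p where p: "real_polynomial_function p" "\<And>w. w \<in> {0..1} \<Longrightarrow> \<bar>q w - p w\<bar> < e / 2"
      by blast
    from p(1) obtain a n where "p = (\<lambda>w. \<Sum>i\<le>n. a i * w ^ i)"
      unfolding real_polynomial_function_iff_sum by blast
    with p(2) have "\<And>w. w \<in> {0..1} \<Longrightarrow> \<bar>q w - (\<Sum>i\<le>n. a i * w ^ i)\<bar> < e / 2" by simp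
    from approx[OF M this] approx[OF N this] show ?thesis
      unfolding dist_real_def L by linarith
  qed
  then show ?thesis by (metis dist_le_zero_iff field_le_epsilon add_0)
qed

text \<open>The integrand tends to \<open>1\<close> at \<open>0\<close> and to \<open>0\<close> at
  infinity, so the uniqueness result applies. It serves to replace \<open>S t\<close> by the
  variable of a fixed maturity.\<close>

lemma expectation_cdf_eq_of_laplace_eq:
  assumes "prob_space M" "X \<in> borel_measurable M" "AE \<omega> in M. 0 < X \<omega>"
    and "prob_space N" "Y \<in> borel_measurable N" "AE \<omega> in N. 0 < Y \<omega>"
    and "\<And>n::nat. laplace_transform M X (real n) = laplace_transform N Y (real n)"
    and pos: "0 < a" "0 < b"
  shows "(\<integral>\<omega>. std_normal_cdf (a / sqrt (X \<omega>) - b * sqrt (X \<omega>)) \<partial>M)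
    = (\<integral>\<omega>. std_normal_cdf (a / sqrt (Y \<omega>) - b * sqrt (Y \<omega>)) \<partial>N)"
proof (rule expectation_eq_of_laplace_eq[OF assms(1-7)])
  let ?h = "\<lambda>x. std_normal_cdf (a / sqrt x - b * sqrt x)"
  show "continuous_on {0<..} ?h" by (intro continuous_intros) auto
  show "(?h \<longlongrightarrow> 1) (at_right 0)"
    by (rule filterlim_compose[OF std_normal_cdf_at_top]) (use pos in real_asymp)
  show "(?h \<longlongrightarrow> 0) at_top"
    by (rule filterlim_compose[OF std_normal_cdf_at_bot]) (use pos in real_asymp)
qed measurable

section \<open>Limits and bounds for the conditioned exercise probability\<close>

lemma (in prob_space) tendsto_expectation_cdf:
  assumes [measurable]: "X \<in> borel_measurable M" and "(a \<longlongrightarrow> a0) (at_right (0::real))" "(b \<longlongrightarrow> b0) (at_right 0)"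
  shows "((\<lambda>t. expectation (\<lambda>\<omega>. std_normal_cdf (a t / sqrt (X \<omega>) - b t * sqrt (X \<omega>)))) \<longlongrightarrow>
    expectation (\<lambda>\<omega>. std_normal_cdf (a0 / sqrt (X \<omega>) - b0 * sqrt (X \<omega>)))) (at_right 0)"
  unfolding tendsto_at_iff_sequentially comp_def
proof (intro allI impI)
  fix T :: "nat \<Rightarrow> real" assume "\<forall>i. T i \<in> {0<..} - {0}" "T \<longlonglongrightarrow> 0"
  then have "filterlim T (at_right 0) sequentially"
    by (auto simp: filterlim_at less_imp_neq[symmetric])
  then have lim: "(\<lambda>n. a (T n)) \<longlonglongrightarrow> a0" "(\<lambda>n. b (T n)) \<longlonglongrightarrow> b0"
    using assms(2,3) by (auto intro: filterlim_compose)
  then show "(\<lambda>n. expectation (\<lambda>\<omega>. std_normal_cdf (a (T n) / sqrt (X \<omega>) - b (T n) * sqrt (X \<omega>)))) \<longlonglongrightarrow>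
      expectation (\<lambda>\<omega>. std_normal_cdf (a0 / sqrt (X \<omega>) - b0 * sqrt (X \<omega>)))"
    by (intro integral_dominated_convergence[where w = "\<lambda>_. 1"])
       (auto intro!: tendsto_intros simp: divide_inverse std_normal_cdf_nonneg std_normal_cdf_le_1)
qed

text \<open>A Markov-type bound. Where \<open>X \<le> \<epsilon>\<close>, monotonicity bounds the
  integrand below by its value with \<open>A\<close>, \<open>B\<close> and
  \<open>\<epsilon>\<close>; where \<open>X > \<epsilon>\<close>, the ratio
  \<open>(1 - exp (- X)) / (1 - exp (- \<epsilon>))\<close> is at least \<open>1\<close> and absorbs
  the loss.\<close>

lemma (in prob_space) expectation_cdf_ge:
  assumes [measurable]: "X \<in> borel_measurable M" and X_pos: "AE \<omega> in M. 0 < X \<omega>"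
    and "0 \<le> A" "A \<le> a" "b \<le> B" "0 \<le> B" "0 < \<epsilon>"
  shows "std_normal_cdf (A / sqrt \<epsilon> - B * sqrt \<epsilon>) - (1 - laplace_transform M X 1) / (1 - exp (- \<epsilon>))
    \<le> expectation (\<lambda>\<omega>. std_normal_cdf (a / sqrt (X \<omega>) - b * sqrt (X \<omega>)))"
proof -
  let ?N = "std_normal_cdf (A / sqrt \<epsilon> - B * sqrt \<epsilon>)"
  have int: "integrable M (\<lambda>\<omega>. exp (- X \<omega>))"
    using X_pos by (intro integrable_const_bound[of _ 1]) (auto elim!: eventually_mono)
  then have "?N - (1 - laplace_transform M X 1) / (1 - exp (- \<epsilon>))
      = expectation (\<lambda>\<omega>. ?N - (1 - exp (- X \<omega>)) / (1 - exp (- \<epsilon>)))"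
    by (simp add: laplace_transform_def prob_space)
  also have "\<dots> \<le> expectation (\<lambda>\<omega>. std_normal_cdf (a / sqrt (X \<omega>) - b * sqrt (X \<omega>)))"
  proof (rule integral_mono_AE)
    show "AE \<omega> in M. ?N - (1 - exp (- X \<omega>)) / (1 - exp (- \<epsilon>))
        \<le> std_normal_cdf (a / sqrt (X \<omega>) - b * sqrt (X \<omega>))"
      using X_pos
    proof eventually_elim
      case (elim \<omega>)
      show ?case
      proof (cases "X \<omega> \<le> \<epsilon>")
        case True
        have "A / sqrt \<epsilon> \<le> a / sqrt (X \<omega>)" "b * sqrt (X \<omega>) \<le> B * sqrt \<epsilon>"
          using True elim assms by (auto intro!: frac_le mult_mono)
        then have "?N \<le> std_normal_cdf (a / sqrt (X \<omega>) - b * sqrt (X \<omega>))"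
          by (intro std_normal_cdf_mono) linarith
        moreover have "0 \<le> (1 - exp (- X \<omega>)) / (1 - exp (- \<epsilon>))"
          using elim assms by simp
        ultimately show ?thesis by linarith
      next
        case False
        then have "1 \<le> (1 - exp (- X \<omega>)) / (1 - exp (- \<epsilon>))"
          using assms by (subst le_divide_eq_1_pos) auto
        with std_normal_cdf_le_1[of "A / sqrt \<epsilon> - B * sqrt \<epsilon>"]
          std_normal_cdf_nonneg[of "a / sqrt (X \<omega>) - b * sqrt (X \<omega>)"]
        show ?thesis by linarith
      qed
    qed
    show "integrable M (\<lambda>\<omega>. std_normal_cdf (a / sqrt (X \<omega>) - b * sqrt (X \<omega>)))"
      by (intro integrable_const_bound[of _ 1]) (auto simp: std_normal_cdf_nonneg std_normal_cdf_le_1)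
  qed (use int in auto)
  finally show ?thesis .
qed

section \<open>Asymptotics of the prescribed log-Laplace transform\<close>

text \<open>From \<open>ln (1 + x) \<le> x\<close> for \<open>\<alpha> = 0\<close>, and otherwise
  from Bernoulli's inequality \<open>(1 + z) powr \<alpha> \<le> 1 + \<alpha> * z\<close>, obtained
  here from Young's inequality. This supplies the hypothesis of
  \<open>expectation_le_of_laplace\<close>.\<close>

lemma ats_log_laplace_ge:
  assumes "0 \<le> \<alpha>" "\<alpha> < 1" "0 < \<kappa>" "0 < t" "0 \<le> u"
  shows "- u \<le> ats_log_laplace \<alpha> \<kappa> t u"
proof (cases "\<alpha> = 0")
  case True
  have "ln (1 + u * \<kappa> / t) \<le> u * \<kappa> / t"
    using assms by (intro ln_add_one_self_le_self) auto
  then have "t / \<kappa> * ln (1 + u * \<kappa> / t) \<le> t / \<kappa> * (u * \<kappa> / t)"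
    using assms by (intro mult_left_mono) auto
  also have "\<dots> = u" using assms by simp
  finally show ?thesis using True by (simp add: ats_log_laplace_def)
next
  case False
  let ?z = "u * \<kappa> / ((1 - \<alpha>) * t)"
  have "0 \<le> ?z" using assms by simp
  then have "0 < 1 + ?z" by linarith
  then have "(1 + ?z) powr \<alpha> * 1 powr (1 - \<alpha>) \<le> \<alpha> * (1 + ?z) + (1 - \<alpha>) * 1"
    using assms by (intro Youngs_inequality_0) auto
  then have "- (\<alpha> * ?z) \<le> 1 - (1 + ?z) powr \<alpha>" by (simp add: algebra_simps)
  then have "t / \<kappa> * ((1 - \<alpha>) / \<alpha>) * - (\<alpha> * ?z) \<le> t / \<kappa> * ((1 - \<alpha>) / \<alpha>) * (1 - (1 + ?z) powr \<alpha>)"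
    using assms by (intro mult_left_mono) auto
  also have "t / \<kappa> * ((1 - \<alpha>) / \<alpha>) * - (\<alpha> * ?z) = - u" using assms False by simp
  finally show ?thesis using False by (simp add: ats_log_laplace_def)
qed

text \<open>For \<delta> = - 1 / 2 the transform is evaluated at an argument proportional to
  \<open>sqrt t\<close>. The inner increment \<open>z t\<close> is then of order
  \<open>t powr (\<beta> - 1 / 2)\<close> and vanishes, so only the derivative of
  \<open>ln (1 + z)\<close> or \<open>(1 + z) powr \<alpha>\<close> at \<open>0\<close>
  matters.\<close>

lemma ats_log_laplace_small_argument:
  assumes "0 \<le> \<alpha>" "\<alpha> < 1" "0 < k" "1 / 2 < \<beta>" "0 < c"
  shows "((\<lambda>t. - ats_log_laplace \<alpha> (scaled k \<beta> t) t (c * sqrt t) / sqrt t) \<longlongrightarrow> c) (at_right 0)"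
proof -
  define z where "z = (\<lambda>t. c * k / (1 - \<alpha>) * t powr (\<beta> - 1 / 2))"
  have z_pos: "0 < z t" if "0 < t" for t using that assms by (simp add: z_def)
  have z_eq: "c * sqrt t * scaled k \<beta> t / ((1 - \<alpha>) * t) = z t"
    "t / scaled k \<beta> t * (1 - \<alpha>) / sqrt t = c / z t" if t: "0 < t" for t
  proof -
    have "sqrt t * t powr \<beta> = t * t powr (\<beta> - 1 / 2)"
      using t powr_add[of t 1 "\<beta> - 1 / 2"] by (simp add: powr_half_sqrt[symmetric] flip: powr_add)
    then have *: "sqrt t * scaled k \<beta> t = t * (k * t powr (\<beta> - 1 / 2))"
      by (simp add: scaled_def)
    show "c * sqrt t * scaled k \<beta> t / ((1 - \<alpha>) * t) = z t"
      using t * by (simp add: z_def mult.assoc)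
    have "t / scaled k \<beta> t * (1 - \<alpha>) / sqrt t = t * (1 - \<alpha>) / (sqrt t * scaled k \<beta> t)"
      by simp
    also have "\<dots> = c / z t"
      unfolding * using t assms by (simp add: z_def)
    finally show "t / scaled k \<beta> t * (1 - \<alpha>) / sqrt t = c / z t" .
  qed
  have "((\<lambda>t. t powr (\<beta> - 1 / 2)) \<longlongrightarrow> 0) (at_right 0)"
    using assms by real_asymp
  then have "(z \<longlongrightarrow> c * k / (1 - \<alpha>) * 0) (at_right 0)"
    unfolding z_def by (intro tendsto_intros)
  then have lim_z: "filterlim z (at 0) (at_right 0)"
    using eventually_mono[OF eventually_at_right_less, of 0 "\<lambda>t. z t \<noteq> 0"] z_pos
    by (force simp: filterlim_at)
  show ?thesis
  proof (cases "\<alpha> = 0")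
    case True
    have "((\<lambda>z. ln (1 + z)) has_real_derivative 1) (at 0)"
      by (auto intro!: derivative_eq_intros)
    then have "((\<lambda>z::real. ln (1 + z) / z) \<longlongrightarrow> 1) (at 0)"
      by (simp add: has_field_derivative_iff)
    from tendsto_mult_left[OF filterlim_compose[OF this lim_z], of c]
    have "((\<lambda>t. c * (ln (1 + z t) / z t)) \<longlongrightarrow> c) (at_right 0)" by simp
    moreover have "\<forall>\<^sub>F t in at_right 0. c * (ln (1 + z t) / z t)
        = - ats_log_laplace \<alpha> (scaled k \<beta> t) t (c * sqrt t) / sqrt t"
      using eventually_at_right_less
    proof eventually_elim
      case (elim t)
      have "c * (ln (1 + z t) / z t) = (c / z t) * ln (1 + z t)" by simp
      also have "\<dots> = - ats_log_laplace \<alpha> (scaled k \<beta> t) t (c * sqrt t) / sqrt t"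
        unfolding z_eq(2)[OF elim, symmetric]
        using z_eq(1)[OF elim] by (simp add: True ats_log_laplace_def)
      finally show ?case .
    qed
    ultimately show ?thesis by (rule Lim_transform_eventually)
  next
    case False
    have "((\<lambda>z. (1 + z) powr \<alpha>) has_real_derivative \<alpha>) (at 0)"
      by (auto intro!: derivative_eq_intros)
    then have "((\<lambda>z. ((1 + z) powr \<alpha> - 1) / z) \<longlongrightarrow> \<alpha>) (at 0)"
      by (simp add: has_field_derivative_iff)
    from tendsto_mult_left[OF filterlim_compose[OF this lim_z], of "c / \<alpha>"]
    have "((\<lambda>t. c / \<alpha> * (((1 + z t) powr \<alpha> - 1) / z t)) \<longlongrightarrow> c) (at_right 0)" using False by simp
    moreover have "\<forall>\<^sub>F t in at_right 0. c / \<alpha> * (((1 + z t) powr \<alpha> - 1) / z t)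
        = - ats_log_laplace \<alpha> (scaled k \<beta> t) t (c * sqrt t) / sqrt t"
      using eventually_at_right_less
    proof eventually_elim
      case (elim t)
      have "c / \<alpha> * (((1 + z t) powr \<alpha> - 1) / z t) = - ((c / z t) / \<alpha> * (1 - (1 + z t) powr \<alpha>))"
        by (simp add: right_diff_distrib diff_divide_distrib mult.commute)
      also have "\<dots> = - ats_log_laplace \<alpha> (scaled k \<beta> t) t (c * sqrt t) / sqrt t"
        unfolding z_eq(2)[OF elim, symmetric]
        using z_eq(1)[OF elim] by (simp add: False ats_log_laplace_def)
      finally show ?case .
    qed
    ultimately show ?thesis by (rule Lim_transform_eventually)
  qed
qed

text \<open>With \<open>\<tau> t = t / scaled k \<beta> t\<close> tending to \<open>0\<close>, the
  expression is of order \<open>\<tau> * ln (1 / \<tau>)\<close> for \<open>\<alpha> = 0\<close> and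
  \<open>\<tau> powr (1 - \<alpha>)\<close> otherwise. This expresses that \<open>S t\<close> tends
  to \<open>0\<close> in probability.\<close>

lemma ats_log_laplace_tendsto_0:
  assumes "0 \<le> \<alpha>" "\<alpha> < 1" "0 < k" "\<beta> < 1"
  shows "((\<lambda>t. ats_log_laplace \<alpha> (scaled k \<beta> t) t 1) \<longlongrightarrow> 0) (at_right 0)"
proof -
  define \<tau> where "\<tau> = (\<lambda>t. t powr (1 - \<beta>) / k)"
  have \<tau>_eq: "t / scaled k \<beta> t = \<tau> t" "scaled k \<beta> t / t = 1 / \<tau> t" if "0 < t" for t
    using that assms by (simp_all add: \<tau>_def scaled_def powr_diff)
  have "filterlim \<tau> (at_right 0) (at_right 0)"
    unfolding \<tau>_def using assms by real_asymp
  moreover have "((\<lambda>x. if \<alpha> = 0 then - x * ln (1 + 1 / x)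
      else x * ((1 - \<alpha>) / \<alpha>) * (1 - (1 + 1 / x / (1 - \<alpha>)) powr \<alpha>)) \<longlongrightarrow> 0) (at_right 0)"
  proof (cases "\<alpha> = 0")
    case False
    then have "0 < \<alpha>" "0 < 1 - \<alpha>" using assms by auto
    then have "((\<lambda>x. x * ((1 - \<alpha>) / \<alpha>) * (1 - (1 + 1 / x / (1 - \<alpha>)) powr \<alpha>)) \<longlongrightarrow> 0) (at_right 0)"
      by real_asymp
    then show ?thesis using False by simp
  qed (simp, real_asymp)
  ultimately have "((\<lambda>t. if \<alpha> = 0 then - \<tau> t * ln (1 + 1 / \<tau> t)
      else \<tau> t * ((1 - \<alpha>) / \<alpha>) * (1 - (1 + 1 / \<tau> t / (1 - \<alpha>)) powr \<alpha>)) \<longlongrightarrow> 0) (at_right 0)"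
    by (rule filterlim_compose[rotated])
  moreover have "\<forall>\<^sub>F t in at_right 0. (if \<alpha> = 0 then - \<tau> t * ln (1 + 1 / \<tau> t)
      else \<tau> t * ((1 - \<alpha>) / \<alpha>) * (1 - (1 + 1 / \<tau> t / (1 - \<alpha>)) powr \<alpha>))
      = ats_log_laplace \<alpha> (scaled k \<beta> t) t 1"
    using eventually_at_right_less
    by eventually_elim (simp add: ats_log_laplace_def mult.commute flip: \<tau>_eq)
  ultimately show ?thesis by (rule Lim_transform_eventually)
qed

lemma ats_log_laplace_linear_scaling:
  assumes "0 < s" "0 < t"
  shows "ats_log_laplace \<alpha> (scaled k 1 s) s u = ats_log_laplace \<alpha> (scaled k 1 t) t u"
  using assms by (simp add: ats_log_laplace_def scaled_def)

text \<open>A vanishing price forces \<open>a\<close> to \<open>0\<close>, since a value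
  \<open>a t \<ge> e\<close> would keep the difference above its positive value at \<open>e\<close>.
  The limit is \<open>(1 / 2 - q) * sqrt (2 * pi)\<close>.\<close>

lemma tendsto_implied_vol_slope:
  assumes a: "\<forall>\<^sub>F t in F. 0 < a t"
    and C: "((\<lambda>t. std_normal_cdf (a t) - std_normal_cdf (- a t)) \<longlongrightarrow> 0) F"
    and p: "(p \<longlongrightarrow> q) F"
  shows "((\<lambda>t. (std_normal_cdf (- a t) - p t) / std_normal_density (a t)) \<longlongrightarrow>
      - sqrt (pi / 2) * (2 * q - 1)) F"
proof -
  have "(a \<longlongrightarrow> 0) F"
  proof (rule tendstoI)
    fix e :: real assume "0 < e"
    then have "0 < std_normal_cdf e - std_normal_cdf (- e)"
      using std_normal_cdf_strict_mono[of "- e" e] by simp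
    from order_tendstoD(2)[OF C this] a show "\<forall>\<^sub>F t in F. dist (a t) 0 < e"
    proof eventually_elim
      case (elim t)
      then show ?case
        using std_normal_cdf_mono[of e "a t"] std_normal_cdf_mono[of "- a t" "- e"]
        by (cases "a t < e") auto
    qed
  qed
  then have "((\<lambda>t. (std_normal_cdf (- a t) - p t) / std_normal_density (a t)) \<longlongrightarrow>
      (std_normal_cdf (- 0) - q) / std_normal_density 0) F"
    using normal_density_pos[of 1 0 0]
    by (intro tendsto_intros p isCont_tendsto_compose[OF isCont_std_normal_density]) auto
  moreover have "sqrt (2 * pi) = 2 * sqrt (pi / 2)"
  proof -
    have "sqrt (2 * pi) = sqrt (2\<^sup>2 * (pi / 2))" by simp
    then show ?thesis by (simp only: real_sqrt_mult real_sqrt_abs abs_numeral)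
  qed
  ultimately show ?thesis
    by (simp add: std_normal_cdf_0 std_normal_density_def algebra_simps)
qed

section \<open>The scaling \<open>\<delta> = - 1 / 2\<close>\<close>

text \<open>The exponent \<delta> is fixed at \<open>- 1 / 2\<close>, and admissibility enters only
  through its consequence \<open>1 / 2 < \<beta>\<close>; both cases of the theorem are
  instances.\<close>

locale ats_scaling =
  fixes \<alpha> k \<sigma> \<eta> \<beta> :: real
    and M :: "real \<Rightarrow> 'a measure" and S g :: "real \<Rightarrow> 'a \<Rightarrow> real"
  assumes \<alpha>: "0 \<le> \<alpha>" "\<alpha> < 1" and params: "0 < k" "0 < \<sigma>" "0 < \<eta>" "1 / 2 < \<beta>"
    and model: "ats_model \<alpha> k \<beta> M S g"
begin

abbreviation "h t \<equiv> scaled \<eta> (- 1 / 2) t"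
abbreviation "Lap t \<equiv> laplace_transform (M t) (S t)"
abbreviation "C t \<equiv> ats_call \<sigma> (h t) (M t) (S t) (g t) t 0"
abbreviation "p t \<equiv> measure (M t) {\<omega> \<in> space (M t). 0 < ats_forward \<sigma> (h t) (M t) (S t) (g t) t \<omega>}"
abbreviation "a t \<equiv> ats_phi \<sigma> (h t) (M t) (S t) t * sqrt t / \<sigma>"
abbreviation "b t \<equiv> (h t + 1 / 2) * \<sigma> * sqrt t"

lemma maturity:
  assumes "0 < t"
  shows "ats_maturity (M t) (S t) (g t) \<sigma> (h t) t"
  using model assms params
  unfolding ats_model_def ats_maturity_def ats_maturity_axioms_def by (auto simp: scaled_def)

lemma ln_laplace: "0 < t \<Longrightarrow> 0 \<le> u \<Longrightarrow> ln (Lap t u) = ats_log_laplace \<alpha> (scaled k \<beta> t) t u"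
  using model unfolding ats_model_def by blast

lemma h_sqrt: "0 < t \<Longrightarrow> h t * sqrt t = \<eta>" "0 < t \<Longrightarrow> h t * t = \<eta> * sqrt t"
  by (simp_all add: scaled_def powr_minus_divide powr_half_sqrt field_simps)

lemma prob_eq:
  assumes "0 < t"
  shows "p t = (\<integral>\<omega>. std_normal_cdf (a t / sqrt (S t \<omega>) - b t * sqrt (S t \<omega>)) \<partial>M t)"
  using ats_maturity.prob_forward_pos[OF maturity[OF assms]] .

lemma call_tendsto_0: "(C \<longlongrightarrow> 0) (at_right 0)"
proof (rule tendsto_sandwich)
  show "\<forall>\<^sub>F t in at_right 0. 0 \<le> C t"
    using eventually_at_right_less
  proof eventually_elim
    case (elim t)
    show ?case using ats_maturity.call_pos[OF maturity[OF elim]] by simp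
  qed
  show "\<forall>\<^sub>F t in at_right 0. C t \<le> (\<eta> * sqrt t + t / 2) * \<sigma>\<^sup>2 + \<sigma> * sqrt t"
    using eventually_at_right_less
  proof eventually_elim
    case (elim t)
    interpret ats_maturity "M t" "S t" "g t" \<sigma> "h t" t by (rule maturity[OF elim])
    have "- u \<le> ln (Lap t u)" if "0 \<le> u" for u
      using ats_log_laplace_ge[of \<alpha> "scaled k \<beta> t" t u] that elim \<alpha> params
      by (simp add: ln_laplace scaled_def)
    then have "C t \<le> (h t + 1 / 2) * \<sigma>\<^sup>2 * t + \<sigma> * sqrt t"
      by (intro call_le integrable_of_laplace expectation_le_of_laplace)
    also have "(h t + 1 / 2) * \<sigma>\<^sup>2 * t = (h t * t + t / 2) * \<sigma>\<^sup>2" by (simp add: algebra_simps)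
    finally show ?case by (simp only: h_sqrt(2)[OF elim])
  qed
  have "((\<lambda>t. (\<eta> * sqrt t + t / 2) * \<sigma>\<^sup>2 + \<sigma> * sqrt t) \<longlongrightarrow> (\<eta> * sqrt 0 + 0 / 2) * \<sigma>\<^sup>2 + \<sigma> * sqrt 0) (at_right 0)"
    by (intro tendsto_intros) auto
  then show "((\<lambda>t. (\<eta> * sqrt t + t / 2) * \<sigma>\<^sup>2 + \<sigma> * sqrt t) \<longlongrightarrow> 0) (at_right 0)" by simp
qed simp

text \<open>The argument \<open>t * \<sigma>\<^sup>2 * h t\<close> equals
  \<open>?c * sqrt t\<close>, so \<open>a t\<close> is the quotient of
  \<open>ats_log_laplace_small_argument\<close> divided by \<open>\<sigma>\<close>.\<close>

lemma a_tendsto: "(a \<longlongrightarrow> \<sigma> * \<eta>) (at_right 0)"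
proof -
  let ?c = "\<sigma>\<^sup>2 * \<eta>"
  have "((\<lambda>t. - ats_log_laplace \<alpha> (scaled k \<beta> t) t (?c * sqrt t) / sqrt t / \<sigma>) \<longlongrightarrow> ?c / \<sigma>) (at_right 0)"
    using \<alpha> params by (intro tendsto_divide tendsto_const ats_log_laplace_small_argument) auto
  moreover have "\<forall>\<^sub>F t in at_right 0. - ats_log_laplace \<alpha> (scaled k \<beta> t) t (?c * sqrt t) / sqrt t / \<sigma> = a t"
    using eventually_at_right_less
  proof eventually_elim
    case (elim t)
    have "t * \<sigma>\<^sup>2 * h t = \<sigma>\<^sup>2 * (h t * t)" by (simp only: ac_simps)
    also have "\<dots> = ?c * sqrt t" unfolding h_sqrt(2)[OF elim] by simp
    finally have "a t = - ln (Lap t (?c * sqrt t)) / t * sqrt t / \<sigma>"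
      by (simp only: ats_phi_def)
    also have "ln (Lap t (?c * sqrt t)) = ats_log_laplace \<alpha> (scaled k \<beta> t) t (?c * sqrt t)"
      using elim params by (intro ln_laplace) auto
    finally have "a t = - ats_log_laplace \<alpha> (scaled k \<beta> t) t (?c * sqrt t) / t * sqrt t / \<sigma>" .
    moreover have "x / t * sqrt t = x / sqrt t" for x using elim by (simp add: field_simps)
    ultimately show ?case by (simp only:)
  qed
  ultimately have "(a \<longlongrightarrow> ?c / \<sigma>) (at_right 0)" by (rule Lim_transform_eventually)
  then show ?thesis using params by (simp add: power2_eq_square)
qed

lemma b_eq: "0 < t \<Longrightarrow> b t = \<sigma> * (\<eta> + sqrt t / 2)"
  using h_sqrt(1)[of t] by (simp add: algebra_simps)

lemma b_tendsto: "(b \<longlongrightarrow> \<sigma> * \<eta>) (at_right 0)"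
proof -
  have "((\<lambda>t. \<sigma> * (\<eta> + sqrt t / 2)) \<longlongrightarrow> \<sigma> * (\<eta> + sqrt 0 / 2)) (at_right 0)"
    by (intro tendsto_intros) simp
  moreover have "\<forall>\<^sub>F t in at_right 0. \<sigma> * (\<eta> + sqrt t / 2) = b t"
    using eventually_at_right_less by eventually_elim (rule b_eq[symmetric])
  ultimately have "(b \<longlongrightarrow> \<sigma> * (\<eta> + sqrt 0 / 2)) (at_right 0)"
    by (rule Lim_transform_eventually)
  then show ?thesis by simp
qed

lemma skew_tendsto:
  assumes "(p \<longlongrightarrow> q) (at_right 0)"
  shows "(skew_term \<sigma> \<eta> (- 1 / 2) M S g \<longlongrightarrow> - sqrt (pi / 2) * (2 * q - 1)) (at_right 0)"
proof -
  have "\<forall>t\<in>{0<..}. \<exists>v. 0 < v \<and> std_normal_cdf v - std_normal_cdf (- v) = C t \<and>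
      skew_term \<sigma> \<eta> (- 1 / 2) M S g t = (std_normal_cdf (- v) - p t) / std_normal_density v"
  proof
    fix t :: real assume "t \<in> {0<..}"
    then have t: "0 < t" by simp
    show "\<exists>v. 0 < v \<and> std_normal_cdf v - std_normal_cdf (- v) = C t \<and>
        skew_term \<sigma> \<eta> (- 1 / 2) M S g t = (std_normal_cdf (- v) - p t) / std_normal_density v"
      by (rule ats_maturity.skew_eq[OF maturity[OF t]]) (auto simp: skew_term_def)
  qed
  \<comment> \<open>Choosing half the total volatility as a function of \<open>t\<close> allows its
    limit to be taken.\<close>
  from bchoice[OF this] obtain v where "\<forall>t\<in>{0<..}. 0 < v t
      \<and> std_normal_cdf (v t) - std_normal_cdf (- v t) = C t
      \<and> skew_term \<sigma> \<eta> (- 1 / 2) M S g t = (std_normal_cdf (- v t) - p t) / std_normal_density (v t)" ..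
  then have v: "0 < v t" "std_normal_cdf (v t) - std_normal_cdf (- v t) = C t"
    "skew_term \<sigma> \<eta> (- 1 / 2) M S g t = (std_normal_cdf (- v t) - p t) / std_normal_density (v t)"
    if "0 < t" for t
    using that by simp_all
  note ev = eventually_mono[OF eventually_at_right_less]
  have "((\<lambda>t. (std_normal_cdf (- v t) - p t) / std_normal_density (v t)) \<longlongrightarrow>
      - sqrt (pi / 2) * (2 * q - 1)) (at_right 0)"
  proof (rule tendsto_implied_vol_slope[OF _ _ assms])
    show "\<forall>\<^sub>F t in at_right 0. 0 < v t" by (rule ev) (rule v(1))
    show "((\<lambda>t. std_normal_cdf (v t) - std_normal_cdf (- v t)) \<longlongrightarrow> 0) (at_right 0)"
      by (rule Lim_transform_eventually[OF call_tendsto_0 ev]) (simp add: v(2))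
  qed
  then show ?thesis
    by (rule Lim_transform_eventually[OF _ ev]) (rule v(3)[symmetric])
qed

lemma prob_tendsto_1:
  assumes "\<beta> < 1"
  shows "(p \<longlongrightarrow> 1) (at_right 0)"
proof (rule order_tendstoI)
  fix y :: real assume "1 < y"
  moreover have "p t \<le> 1" if "0 < t" for t
  proof -
    interpret ats_maturity "M t" "S t" "g t" \<sigma> "h t" t by (rule maturity[OF that])
    show ?thesis by (rule prob_le_1)
  qed
  ultimately show "\<forall>\<^sub>F t in at_right 0. p t < y"
    by (intro eventually_mono[OF eventually_at_right_less]) fastforce
next
  fix y :: real assume y: "y < 1"
  \<comment> \<open>Half and twice the common limit of \<open>a\<close> and \<open>b\<close>, so
    that eventually \<open>?A < a t\<close> and \<open>b t < ?B\<close>. First \<open>e\<close> is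
    chosen to bring the normal term above \<open>y\<close>; then \<open>t\<close> is made small to
    remove the error term with \<open>Lap t 1\<close>.\<close>
  let ?A = "\<sigma> * \<eta> / 2" and ?B = "\<sigma> * \<eta> * 2"
  have "0 < \<sigma> * \<eta>" using params by simp
  then have "((\<lambda>e. std_normal_cdf (?A / sqrt e - ?B * sqrt e)) \<longlongrightarrow> 1) (at_right 0)"
    by (intro filterlim_compose[OF std_normal_cdf_at_top]) real_asymp
  from order_tendstoD(1)[OF this y] eventually_at_right_less[of 0]
  have "\<forall>\<^sub>F e in at_right 0. y < std_normal_cdf (?A / sqrt e - ?B * sqrt e) \<and> 0 < e"
    by eventually_elim auto
  then obtain e where e: "y < std_normal_cdf (?A / sqrt e - ?B * sqrt e)" "0 < e"
    by (auto dest: eventually_happens)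
  have "((\<lambda>t. exp (ats_log_laplace \<alpha> (scaled k \<beta> t) t 1)) \<longlongrightarrow> exp 0) (at_right 0)"
    by (intro tendsto_exp ats_log_laplace_tendsto_0 \<alpha> params assms)
  moreover have "\<forall>\<^sub>F t in at_right 0. exp (ats_log_laplace \<alpha> (scaled k \<beta> t) t 1) = Lap t 1"
    using eventually_at_right_less
  proof eventually_elim
    case (elim t)
    then show ?case
      using ats_maturity.laplace_pos[OF maturity[OF elim], of 1] ln_laplace[OF elim, of 1, symmetric]
      by simp
  qed
  ultimately have "((\<lambda>t. Lap t 1) \<longlongrightarrow> exp 0) (at_right 0)" by (rule Lim_transform_eventually)
  then have "((\<lambda>t. std_normal_cdf (?A / sqrt e - ?B * sqrt e) - (1 - Lap t 1) / (1 - exp (- e))) \<longlongrightarrow>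
      std_normal_cdf (?A / sqrt e - ?B * sqrt e) - (1 - exp 0) / (1 - exp (- e))) (at_right 0)"
    using e by (intro tendsto_intros) auto
  then have "\<forall>\<^sub>F t in at_right 0.
      y < std_normal_cdf (?A / sqrt e - ?B * sqrt e) - (1 - Lap t 1) / (1 - exp (- e))"
    by (rule order_tendstoD(1)) (use e in simp)
  moreover have "\<forall>\<^sub>F t in at_right 0. ?A < a t" "\<forall>\<^sub>F t in at_right 0. b t < ?B"
    using \<open>0 < \<sigma> * \<eta>\<close>
    by (intro order_tendstoD(1)[OF a_tendsto] order_tendstoD(2)[OF b_tendsto]; linarith)+
  moreover have "\<forall>\<^sub>F t in at_right 0. (0::real) < t" by (rule eventually_at_right_less)
  ultimately show "\<forall>\<^sub>F t in at_right 0. y < p t"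
  proof eventually_elim
    case (elim t)
    interpret ats_maturity "M t" "S t" "g t" \<sigma> "h t" t by (rule maturity[OF elim(4)])
    have "std_normal_cdf (?A / sqrt e - ?B * sqrt e) - (1 - Lap t 1) / (1 - exp (- e))
        \<le> (\<integral>\<omega>. std_normal_cdf (a t / sqrt (S t \<omega>) - b t * sqrt (S t \<omega>)) \<partial>M t)"
      using elim e \<open>0 < \<sigma> * \<eta>\<close> by (intro expectation_cdf_ge X X_pos) auto
    with elim show ?case by (simp only: prob_eq[OF elim(4)])
  qed
qed

text \<open>For \<open>\<beta> = 1\<close> the transforms at all maturities agree, so
  \<open>S t\<close> may be replaced by \<open>S s\<close> inside the expectation. Then only
  \<open>a t\<close> and \<open>b t\<close> vary with \<open>t\<close>, over one fixed probability
  space.\<close>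

lemma prob_tendsto_expectation:
  assumes "\<beta> = 1" and s: "0 < s"
  shows "(p \<longlongrightarrow> (\<integral>\<omega>. std_normal_cdf (\<sigma> * \<eta> / sqrt (S s \<omega>) - \<sigma> * \<eta> * sqrt (S s \<omega>)) \<partial>M s)) (at_right 0)"
proof -
  interpret s: ats_maturity "M s" "S s" "g s" \<sigma> "h s" s by (rule maturity[OF s])
  have "0 < \<sigma> * \<eta>" using params by simp
  then have "\<forall>\<^sub>F t in at_right 0. 0 < a t" by (rule order_tendstoD(1)[OF a_tendsto])
  with eventually_at_right_less[of 0]
  have "\<forall>\<^sub>F t in at_right 0.
      (\<integral>\<omega>. std_normal_cdf (a t / sqrt (S s \<omega>) - b t * sqrt (S s \<omega>)) \<partial>M s) = p t"
  proof eventually_elim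
    case (elim t)
    interpret ats_maturity "M t" "S t" "g t" \<sigma> "h t" t by (rule maturity[OF elim(1)])
    have "ln (Lap t u) = ln (Lap s u)" if "0 \<le> u" for u
      using that ats_log_laplace_linear_scaling[OF s elim(1), of \<alpha> k u] assms elim(1)
      by (simp add: ln_laplace)
    then have eq: "Lap s (real n) = Lap t (real n)" for n
      by (metis laplace_pos s.laplace_pos ln_inj_iff of_nat_0_le_iff)
    have "0 < b t" unfolding b_eq[OF elim(1)] using params elim(1) by (simp add: add_pos_nonneg)
    then show ?case
      unfolding prob_eq[OF elim(1)] using elim(2)
      by (intro expectation_cdf_eq_of_laplace_eq eq s.X s.X_pos X X_pos) unfold_locales
  qed
  with s.tendsto_expectation_cdf[OF s.X a_tendsto b_tendsto] show ?thesis
    by (rule Lim_transform_eventually)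
qed

end

text \<open>For \<open>\<beta> = 1\<close> the expectation is taken at an arbitrary reference
  maturity \<open>s\<close>, as the law of \<open>S s\<close> is the same for all of them.\<close>

theorem proposition4p3:
  fixes \<alpha> k \<sigma> \<eta> \<beta> \<delta> :: real
    and M :: "real \<Rightarrow> 'a measure" and S g :: "real \<Rightarrow> 'a \<Rightarrow> real"
  assumes "0 \<le> \<alpha>" "\<alpha> < 1" and "0 < k" "0 < \<sigma>" "0 < \<eta>"
    and "admissible \<alpha> \<beta> \<delta>"
    and "ats_model \<alpha> k \<beta> M S g"
  shows "(\<beta> < 1 \<and> \<delta> = - 1 / 2 \<longrightarrow>
            ((\<lambda>t. skew_term \<sigma> \<eta> \<delta> M S g t) \<longlongrightarrow> - sqrt (pi / 2)) (at_right 0)) \<and>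
         (\<beta> = 1 \<and> \<delta> = - 1 / 2 \<longrightarrow>
            (\<forall>s>0. ((\<lambda>t. skew_term \<sigma> \<eta> \<delta> M S g t) \<longlongrightarrow>
               - sqrt (pi / 2) * (\<integral>\<omega>. erf (\<sigma> * \<eta> * r_fun (S s \<omega>)) \<partial>M s)) (at_right 0)))"
proof (intro conjI impI allI)
  \<comment> \<open>The value \<open>\<delta> = - 1 / 2\<close> rules out the alternative
    \<open>\<beta> = \<delta> = 0\<close>, and the strict lower bound on \<open>\<delta>\<close>
    then gives \<open>1 / 2 < \<beta>\<close>.\<close>
  have scaling: "ats_scaling \<alpha> k \<sigma> \<eta> \<beta> M S g" if "\<delta> = - 1 / 2"
    using assms that unfolding ats_scaling_def admissible_def by (auto split: if_splits)
  show "((\<lambda>t. skew_term \<sigma> \<eta> \<delta> M S g t) \<longlongrightarrow> - sqrt (pi / 2)) (at_right 0)"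
    if "\<beta> < 1 \<and> \<delta> = - 1 / 2"
  proof -
    interpret ats_scaling \<alpha> k \<sigma> \<eta> \<beta> M S g using that by (intro scaling) simp
    show ?thesis using skew_tendsto[OF prob_tendsto_1] that by simp
  qed
  fix s :: real assume s: "0 < s" and eq: "\<beta> = 1 \<and> \<delta> = - 1 / 2"
  interpret ats_scaling \<alpha> k \<sigma> \<eta> \<beta> M S g using eq by (intro scaling) simp
  interpret s: ats_maturity "M s" "S s" "g s" \<sigma> "h s" s by (rule maturity[OF s])
  let ?N = "\<lambda>\<omega>. std_normal_cdf (\<sigma> * \<eta> / sqrt (S s \<omega>) - \<sigma> * \<eta> * sqrt (S s \<omega>))"
  \<comment> \<open>The factor \<open>sqrt 2\<close> in \<open>r_fun\<close> cancels the division by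
    \<open>sqrt 2\<close> in this normalization of \<open>erf\<close>.\<close>
  have "erf (\<sigma> * \<eta> * r_fun (S s \<omega>)) = 2 * ?N \<omega> - 1" for \<omega>
  proof -
    have "\<sigma> * \<eta> * r_fun (S s \<omega>) / sqrt 2 = \<sigma> * \<eta> * (1 / sqrt (S s \<omega>) - sqrt (S s \<omega>))"
      by (simp add: r_fun_def)
    then show ?thesis by (simp add: erf_def right_diff_distrib)
  qed
  moreover have "integrable (M s) ?N"
    by (intro s.integrable_const_bound[of _ 1]) (auto simp: std_normal_cdf_nonneg std_normal_cdf_le_1)
  ultimately have "(\<integral>\<omega>. erf (\<sigma> * \<eta> * r_fun (S s \<omega>)) \<partial>M s) = 2 * (\<integral>\<omega>. ?N \<omega> \<partial>M s) - 1"
    by (simp add: s.prob_space)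
  with skew_tendsto[OF prob_tendsto_expectation[OF _ s]] eq
  show "((\<lambda>t. skew_term \<sigma> \<eta> \<delta> M S g t) \<longlongrightarrow>
      - sqrt (pi / 2) * (\<integral>\<omega>. erf (\<sigma> * \<eta> * r_fun (S s \<omega>)) \<partial>M s)) (at_right 0)"
    by simp
qed

end
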